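(* Suppose that the matrix-structure hypothesis, the index-1 hypothesis, the coupled monotonicity hypothesis and the polynomial regularity hypothesis (all stated in the context) hold. Let $\theta\in[\frac12,1]$ and let $$\bar\Delta:=\min\Big\{\Delta_0,\ \frac{1}{4\theta L_1(1+\hat L^2)}\Big\},\qquad \hat L:=\Big(\sup_{t\in[0,T]}|A_t|\Big)L_J+d .$$ Then, for every stepsize $\Delta=T/K$, $K\in\mathbb N$, with $0<\Delta\le\bar\Delta$, the stochastic theta Milstein method with parameter $\theta$ is well defined (the implicit recursion started from $x_0=X_0$ has a unique solution $\{x_k\}_{k=0}^{K}$) and $$x_k\in\mathcal M_{t_k}:=\{x\in\mathbb R^d:RF(t_k,x)=0\},\qquad k=0,1,\dots,K .$$
   Context: Notation and equation. $|\cdot|$ is the Euclidean norm of vectors and the Frobenius norm $|B|=\sqrt{\operatorname{trace}(B^\top B)}$ of matrices; $\langle\cdot,\cdot\rangle$ is the Euclidean inner product; $\partial_xH$ is the Jacobian of $H$ in $x$. Let $T>0$ and let $\{W_t\}_{t\in[0,T]}$ be an $m$-dimensional standard Brownian motion on a filtered probability space with filtration $(\mathcal F_t)$. Let $A_t\in\mathbb R^{d\times d}$, $t\in[0,T]$, be singular matrices, $F:[0,T]\times\mathbb R^d\to\mathbb R^d$, $G=(G_1,\dots,G_m):[0,T]\times\mathbb R^d\to\mathbb R^{d\times m}$ with columns $G_j$. The SDAE being discretized is $A_t\,dX_t=F(t,X_t)\,dt+G(t,X_t)\,dW_t$, $t\in(0,T]$, with initial value $X_0$. $A_t^-$ is the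 Moore–Penrose inverse of $A_t$; $P:=A_t^-A_t$, $R:=I-A_tA_t^-$ (time independent under the matrix-structure hypothesis). Matrix-structure hypothesis: $A_t=M\Sigma_tN$ with $M,N\in\mathbb R^{d\times d}$ time-independent orthogonal matrices, $\Sigma_t=\operatorname{diag}(\sigma_1(t),\dots,\sigma_r(t),0,\dots,0)$ continuously differentiable, $r\in\{1,\dots,d-1\}$; each $\sigma_i\in C^2([0,T];\mathbb R)$, and there are constants $\underline\sigma,\overline\sigma,C_\sigma>0$ with $0<\underline\sigma\le\sigma_i(t)\le\overline\sigma<\infty$, $|\sigma_i'(t)|+|\sigma_i''(t)|\le C_\sigma$ for all $t\in[0,T]$, $i\le r$. Index-1 hypothesis: $X_0$ is deterministic with $RF(0,X_0)=0$; $J(t,x):=A_t+R\,\partial_xF(t,x)$ is invertible for all $(t,x)\in[0,T]\times\mathbb R^d$ and $\sup_{(t,x)}|J(t,x)^{-1}|\le L_J$ for a constant $L_J>0$; and $RG(t,x)=0$ for all $(t,x)$. Milstein coefficient: $\widetilde{\mathcal L}^{j_1}G_{j_2}(t,x):=\partial_xG_{j_2}(t,x)J(t,x)^{-1}G_{j_1}(t,x)$, $j_1,j_2=1,\dots,m$. Coupled monotonicity hypothesis: there are constants $q>1$, $p_1>8$, $L_1>0$, $\Delta_0\in(0,T]$ such that for all $x,y\in\mathbb R^d$, $t\in[0,T]$, $$2\langle Px-Py,A_t^-F(t,x)-A_t^-F(t,y)\rangle+(p_1-1)|A_t^-G(t,x)-A_t^-G(t,y)|^2+\tfrac q2\Delta_0\sum_{j_1,j_2=1}^m|A_t^-\widetilde{\mathcal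 L}^{j_1}G_{j_2}(t,x)-A_t^-\widetilde{\mathcal L}^{j_1}G_{j_2}(t,y)|^2\le L_1|x-y|^2.$$ Polynomial regularity hypothesis: $F,G_1,\dots,G_m\in C^{1,2}([0,T]\times\mathbb R^d)$, and there are constants $\gamma\in[1,\frac{p_1+2}{10})$, $C>0$ such that for all $x,y\in\mathbb R^d$, $s,t\in[0,T]$, $j=1,\dots,m$, with $\rho:=1+|x|+|y|$: $|\partial_xF(t,x)-\partial_xF(s,y)|\le C(\rho^{\gamma-2}|x-y|+\rho^\gamma|t-s|)$; $|\partial_tF(t,x)-\partial_tF(s,y)|\le C(\rho^{\gamma-1}|x-y|+\rho^\gamma|t-s|)$; $|\partial_xG_j(t,x)-\partial_xG_j(s,y)|^2\le C(\rho^{\gamma-3}|x-y|^2+\rho^{\gamma+1}|t-s|^2)$; $|\partial_tG_j(t,x)-\partial_tG_j(s,y)|^2\le C(\rho^{\gamma-1}|x-y|^2+\rho^{\gamma+1}|t-s|^2)$. Stochastic theta Milstein method: $\Delta=T/K$, $t_k=k\Delta$, $x_0=X_0$ and, for $k=0,\dots,K-1$, $$A_{t_k}x_{k+1}=A_{t_k}x_k+\theta(R+A_{t_k}A_{t_{k+1}}^-)F(t_{k+1},x_{k+1})\Delta+(1-\theta)F(t_k,x_k)\Delta+G(t_k,x_k)\Delta W_k+\sum_{j_1,j_2=1}^m\widetilde{\mathcal L}^{j_1}G_{j_2}(t_k,x_k)I_{j_1,j_2}^{t_k,t_{k+1}},$$ with $\Delta W_k=W_{t_{k+1}}-W_{t_k}$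 and $I_{j_1,j_2}^{t_k,t_{k+1}}=\int_{t_k}^{t_{k+1}}\int_{t_k}^{s_2}dW_{s_1}^{j_1}\,dW_{s_2}^{j_2}$. *)

theory Defs
  imports "HOL-Probability.Probability"
begin

text \<open>
  On \<open>real^'n^'m\<close> the library norm is the Euclidean norm of the Euclidean norms of the rows, that is,
  the Frobenius norm.
\<close>

lemma norm_matrix_eq_frobenius:
  fixes B :: "real^'n^'m"
  shows "norm B = sqrt (trace (transpose B ** B))"
proof -
  have "trace (transpose B ** B) = (\<Sum>i\<in>UNIV. \<Sum>j\<in>UNIV. (B $ j $ i)\<^sup>2)"
    by (simp add: trace_def matrix_matrix_mult_def transpose_def power2_eq_square)
  also have "\<dots> = (\<Sum>j\<in>UNIV. \<Sum>i\<in>UNIV. (B $ j $ i)\<^sup>2)"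
    by (rule sum.swap)
  finally show ?thesis
    by (simp add: norm_eq_sqrt_inner inner_vec_def power2_eq_square)
qed

definition is_mp_inverse :: "real^'n^'m \<Rightarrow> real^'m^'n \<Rightarrow> bool" where
  "is_mp_inverse B X \<longleftrightarrow>
     B ** X ** B = B \<and> X ** B ** X = X \<and>
     transpose (B ** X) = B ** X \<and> transpose (X ** B) = X ** B"

definition mp_inverse :: "real^'n^'m \<Rightarrow> real^'m^'n" where
  "mp_inverse B = (THE X. is_mp_inverse B X)"

lemma is_mp_inverse_unique:
  assumes "is_mp_inverse B X" "is_mp_inverse B Y"
  shows "X = Y"
proof -
  have X: "B ** X ** B = B" "X ** B ** X = X" "transpose (B ** X) = B ** X" "transpose (X ** B) = X ** B"
    and Y: "B ** Y ** B = B" "Y ** B ** Y = Y" "transpose (B ** Y) = B ** Y" "transpose (Y ** B) = Y ** B"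
    using assms by (simp_all add: is_mp_inverse_def)
  have "transpose (B ** X) = transpose ((B ** Y) ** (B ** X))"
    by (simp add: matrix_mul_assoc Y(1))
  also have "\<dots> = (B ** X) ** (B ** Y)"
    by (simp only: matrix_transpose_mul[of "B ** Y"] X(3) Y(3))
  also have "\<dots> = B ** Y"
    by (simp add: matrix_mul_assoc X(1))
  finally have BX: "B ** X = B ** Y"
    by (simp only: X(3))
  have "transpose (X ** B) = transpose ((X ** B) ** (Y ** B))"
    by (metis Y(1) matrix_mul_assoc)
  also have "\<dots> = (Y ** B) ** (X ** B)"
    by (simp only: matrix_transpose_mul[of "X ** B"] X(4) Y(4))
  also have "\<dots> = Y ** (B ** X ** B)"
    by (simp add: matrix_mul_assoc)
  also have "\<dots> = Y ** B"
    by (simp only: X(1))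
  finally have XB: "X ** B = Y ** B"
    by (simp only: X(4))
  have "X = X ** (B ** X)"
    by (simp add: matrix_mul_assoc X(2))
  also have "\<dots> = Y ** B ** Y"
    by (simp add: BX XB matrix_mul_assoc)
  also have "\<dots> = Y"
    by (rule Y(2))
  finally show ?thesis .
qed

lemma mp_inverse_eqI: "is_mp_inverse B X \<Longrightarrow> mp_inverse B = X"
  unfolding mp_inverse_def by (blast intro: is_mp_inverse_unique)

text \<open>
  The projectors are written with a time argument; under the matrix-structure hypothesis below they
  do not depend on it (lemma \<open>projectors_constant\<close>).
\<close>

definition projP :: "(real \<Rightarrow> real^'d^'d) \<Rightarrow> real \<Rightarrow> real^'d^'d" where
  "projP A t = mp_inverse (A t) ** A t"

definition projR :: "(real \<Rightarrow> real^'d^'d) \<Rightarrow> real \<Rightarrow> real^'d^'d" where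
  "projR A t = mat 1 - A t ** mp_inverse (A t)"

text \<open>
  Vectors in \<open>\<real>\<^sup>d\<close> are indexed by a finite linearly ordered type \<open>'d\<close> with \<open>CARD('d) = d\<close>;
  \<open>coord_pos i\<close> is the position of \<open>i\<close> in \<open>1, \<dots>, d\<close>, and \<open>diag_first r s\<close> is
  \<open>diag(s 1, \<dots>, s r, 0, \<dots>, 0)\<close>.
\<close>

definition coord_pos :: "'d::{finite,linorder} \<Rightarrow> nat" where
  "coord_pos i = card {j. j \<le> i}"

definition diag_first :: "nat \<Rightarrow> (nat \<Rightarrow> real) \<Rightarrow> real^('d::{finite,linorder})^('d::{finite,linorder})" where
  "diag_first r s = (\<chi> i j. if i = j \<and> coord_pos i \<le> r then s (coord_pos i) else 0)"

text \<open>
  Time derivatives are taken relative to \<open>{0..T}\<close>, hence one-sided at the end points.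
\<close>

definition matrix_structure :: "real \<Rightarrow> (real \<Rightarrow> real^('d::{finite,linorder})^('d::{finite,linorder})) \<Rightarrow> bool" where
  "matrix_structure T A \<longleftrightarrow>
     (\<exists>U V r \<sigma> \<sigma>' \<sigma>'' \<sigma>lo \<sigma>up C\<sigma>.
        orthogonal_matrix U \<and> orthogonal_matrix V \<and>
        1 \<le> r \<and> r \<le> CARD('d) - 1 \<and>
        (\<forall>t\<in>{0..T}. A t = U ** diag_first r (\<lambda>i. \<sigma> i t) ** V) \<and>
        0 < \<sigma>lo \<and> 0 < \<sigma>up \<and> 0 < C\<sigma> \<and>
        (\<forall>i\<in>{1..r}.
           (\<forall>t\<in>{0..T}. (\<sigma> i has_real_derivative \<sigma>' i t) (at t within {0..T})) \<and>
           (\<forall>t\<in>{0..T}. (\<sigma>' i has_real_derivative \<sigma>'' i t) (at t within {0..T})) \<and>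
           continuous_on {0..T} (\<sigma>'' i) \<and>
           (\<forall>t\<in>{0..T}. \<sigma>lo \<le> \<sigma> i t \<and> \<sigma> i t \<le> \<sigma>up \<and>
              \<bar>\<sigma>' i t\<bar> + \<bar>\<sigma>'' i t\<bar> \<le> C\<sigma>)))"

definition Dx :: "(real \<Rightarrow> real^'d \<Rightarrow> real^'d) \<Rightarrow> real \<Rightarrow> real^'d \<Rightarrow> real^'d^'d" where
  "Dx f t x = jacobian (f t) (at x)"

definition Dt :: "real \<Rightarrow> (real \<Rightarrow> real^'d \<Rightarrow> real^'d) \<Rightarrow> real \<Rightarrow> real^'d \<Rightarrow> real^'d" where
  "Dt T f t x = vector_derivative (\<lambda>s. f s x) (at t within {0..T})"

abbreviation gcol :: "(real \<Rightarrow> real^'d \<Rightarrow> real^'m^'d) \<Rightarrow> 'm \<Rightarrow> real \<Rightarrow> real^'d \<Rightarrow> real^'d" where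
  "gcol G j t x \<equiv> column j (G t x)"

definition Jmat :: "(real \<Rightarrow> real^'d^'d) \<Rightarrow> (real \<Rightarrow> real^'d \<Rightarrow> real^'d) \<Rightarrow> real \<Rightarrow> real^'d \<Rightarrow> real^'d^'d" where
  "Jmat A F t x = A t + projR A t ** Dx F t x"

definition index_one ::
  "real \<Rightarrow> (real \<Rightarrow> real^'d^'d) \<Rightarrow> (real \<Rightarrow> real^'d \<Rightarrow> real^'d) \<Rightarrow> (real \<Rightarrow> real^'d \<Rightarrow> real^'m^'d)
     \<Rightarrow> real^'d \<Rightarrow> real \<Rightarrow> bool" where
  "index_one T A F G X0 LJ \<longleftrightarrow>
     projR A 0 *v F 0 X0 = 0 \<and> 0 < LJ \<and>
     (\<forall>t\<in>{0..T}. \<forall>x. invertible (Jmat A F t x) \<and> norm (matrix_inv (Jmat A F t x)) \<le> LJ) \<and>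
     (\<forall>t\<in>{0..T}. \<forall>x. projR A t ** G t x = 0)"

definition milstein_coeff ::
  "(real \<Rightarrow> real^'d^'d) \<Rightarrow> (real \<Rightarrow> real^'d \<Rightarrow> real^'d) \<Rightarrow> (real \<Rightarrow> real^'d \<Rightarrow> real^'m^'d)
     \<Rightarrow> 'm \<Rightarrow> 'm \<Rightarrow> real \<Rightarrow> real^'d \<Rightarrow> real^'d" where
  "milstein_coeff A F G j1 j2 t x =
     (Dx (gcol G j2) t x ** matrix_inv (Jmat A F t x)) *v gcol G j1 t x"

definition coupled_monotone ::
  "real \<Rightarrow> (real \<Rightarrow> real^'d^'d) \<Rightarrow> (real \<Rightarrow> real^'d \<Rightarrow> real^'d) \<Rightarrow> (real \<Rightarrow> real^'d \<Rightarrow> real^'m^'d)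
     \<Rightarrow> real \<Rightarrow> real \<Rightarrow> real \<Rightarrow> real \<Rightarrow> bool" where
  "coupled_monotone T A F G q p1 L1 \<Delta>0 \<longleftrightarrow>
     1 < q \<and> 8 < p1 \<and> 0 < L1 \<and> 0 < \<Delta>0 \<and> \<Delta>0 \<le> T \<and>
     (\<forall>t\<in>{0..T}. \<forall>x y.
        2 * ((projP A t *v x - projP A t *v y) \<bullet>
             (mp_inverse (A t) *v F t x - mp_inverse (A t) *v F t y))
        + (p1 - 1) * (norm (mp_inverse (A t) ** G t x - mp_inverse (A t) ** G t y))\<^sup>2
        + q / 2 * \<Delta>0 * (\<Sum>j1\<in>UNIV. \<Sum>j2\<in>UNIV.
             (norm (mp_inverse (A t) *v milstein_coeff A F G j1 j2 t x
                    - mp_inverse (A t) *v milstein_coeff A F G j1 j2 t y))\<^sup>2)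
        \<le> L1 * (norm (x - y))\<^sup>2)"

text \<open>
  The class \<open>C\<^sup>1\<^sup>,\<^sup>2([0,T] \<times> \<real>\<^sup>d)\<close>: \<open>\<partial>\<^sub>t f\<close>, \<open>\<partial>\<^sub>x f\<close> and \<open>\<partial>\<^sub>x\<^sub>x f\<close> exist and are jointly continuous. The
  second derivative at \<open>(t, x)\<close> is the linear map \<open>h \<mapsto> \<partial>\<^sub>x\<^sub>x f(t, x) h\<close> into the matrices; in finite
  dimension its continuity amounts to continuity for each direction \<open>h\<close>.
\<close>

definition C12 :: "real \<Rightarrow> (real \<Rightarrow> real^'d \<Rightarrow> real^'d) \<Rightarrow> bool" where
  "C12 T f \<longleftrightarrow>
     continuous_on ({0..T} \<times> UNIV) (\<lambda>(t, x). f t x) \<and>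
     (\<forall>t\<in>{0..T}. \<forall>x. (\<lambda>s. f s x) differentiable (at t within {0..T})) \<and>
     continuous_on ({0..T} \<times> UNIV) (\<lambda>(t, x). Dt T f t x) \<and>
     (\<forall>t\<in>{0..T}. \<forall>x. f t differentiable (at x)) \<and>
     continuous_on ({0..T} \<times> UNIV) (\<lambda>(t, x). Dx f t x) \<and>
     (\<forall>t\<in>{0..T}. \<forall>x. Dx f t differentiable (at x)) \<and>
     (\<forall>h. continuous_on ({0..T} \<times> UNIV) (\<lambda>(t, x). frechet_derivative (Dx f t) (at x) h))"

definition poly_regular ::
  "real \<Rightarrow> (real \<Rightarrow> real^'d \<Rightarrow> real^'d) \<Rightarrow> (real \<Rightarrow> real^'d \<Rightarrow> real^'m^'d) \<Rightarrow> real \<Rightarrow> bool" where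
  "poly_regular T F G p1 \<longleftrightarrow>
     C12 T F \<and> (\<forall>j. C12 T (gcol G j)) \<and>
     (\<exists>\<gamma> C. 1 \<le> \<gamma> \<and> \<gamma> < (p1 + 2) / 10 \<and> 0 < C \<and>
        (\<forall>x y. \<forall>s\<in>{0..T}. \<forall>t\<in>{0..T}. let \<rho> = 1 + norm x + norm y in
           norm (Dx F t x - Dx F s y)
             \<le> C * (\<rho> powr (\<gamma> - 2) * norm (x - y) + \<rho> powr \<gamma> * \<bar>t - s\<bar>) \<and>
           norm (Dt T F t x - Dt T F s y)
             \<le> C * (\<rho> powr (\<gamma> - 1) * norm (x - y) + \<rho> powr \<gamma> * \<bar>t - s\<bar>) \<and>
           (\<forall>j. (norm (Dx (gcol G j) t x - Dx (gcol G j) s y))\<^sup>2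
             \<le> C * (\<rho> powr (\<gamma> - 3) * (norm (x - y))\<^sup>2 + \<rho> powr (\<gamma> + 1) * \<bar>t - s\<bar>\<^sup>2)) \<and>
           (\<forall>j. (norm (Dt T (gcol G j) t x - Dt T (gcol G j) s y))\<^sup>2
             \<le> C * (\<rho> powr (\<gamma> - 1) * (norm (x - y))\<^sup>2 + \<rho> powr (\<gamma> + 1) * \<bar>t - s\<bar>\<^sup>2))))"

definition filtration_on :: "real \<Rightarrow> 'a measure \<Rightarrow> (real \<Rightarrow> 'a measure) \<Rightarrow> bool" where
  "filtration_on T M Fl \<longleftrightarrow>
     (\<forall>t\<in>{0..T}. subalgebra M (Fl t)) \<and>
     (\<forall>s\<in>{0..T}. \<forall>t\<in>{0..T}. s \<le> t \<longrightarrow> sets (Fl s) \<subseteq> sets (Fl t))"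

definition brownian_motion ::
  "real \<Rightarrow> 'a measure \<Rightarrow> (real \<Rightarrow> 'a measure) \<Rightarrow> (real \<Rightarrow> 'a \<Rightarrow> real^'m) \<Rightarrow> bool" where
  "brownian_motion T M Fl W \<longleftrightarrow>
     (\<forall>t\<in>{0..T}. W t \<in> borel_measurable (Fl t)) \<and>
     (AE \<omega> in M. W 0 \<omega> = 0) \<and>
     (AE \<omega> in M. continuous_on {0..T} (\<lambda>t. W t \<omega>)) \<and>
     (\<forall>s\<in>{0..T}. \<forall>t\<in>{0..T}. s < t \<longrightarrow>
        prob_space.indep_set M (sets (Fl s))
          {(\<lambda>\<omega>. W t \<omega> - W s \<omega>) -` B \<inter> space M | B. B \<in> sets borel} \<and>
        prob_space.indep_vars M (\<lambda>_. borel) (\<lambda>j \<omega>. (W t \<omega> - W s \<omega>) $ j) UNIV \<and>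
        (\<forall>j. distributed M lborel (\<lambda>\<omega>. (W t \<omega> - W s \<omega>) $ j) (normal_density 0 (sqrt (t - s)))))"

text \<open>
  Elementary processes \<open>\<Sum>\<^sub>i \<xi>\<^sub>i \<cdot> 1_(\<tau>\<^sub>i, \<tau>\<^sub>i\<^sub>+\<^sub>1]\<close> on \<open>[s, t]\<close>, with bounded \<open>\<xi>\<^sub>i\<close> measurable at time \<open>\<tau>\<^sub>i\<close>.
\<close>

definition elementary_on ::
  "(real \<Rightarrow> 'a measure) \<Rightarrow> real \<Rightarrow> real \<Rightarrow> nat \<Rightarrow> (nat \<Rightarrow> real) \<Rightarrow> (nat \<Rightarrow> 'a \<Rightarrow> real) \<Rightarrow> bool" where
  "elementary_on Fl s t n \<tau> \<xi> \<longleftrightarrow>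
     \<tau> 0 = s \<and> \<tau> n = t \<and>
     (\<forall>i<n. \<tau> i \<le> \<tau> (Suc i) \<and> \<xi> i \<in> borel_measurable (Fl (\<tau> i)) \<and>
        (\<exists>c. \<forall>\<omega>\<in>space (Fl (\<tau> i)). \<bar>\<xi> i \<omega>\<bar> \<le> c))"

definition elementary_process ::
  "nat \<Rightarrow> (nat \<Rightarrow> real) \<Rightarrow> (nat \<Rightarrow> 'a \<Rightarrow> real) \<Rightarrow> real \<Rightarrow> 'a \<Rightarrow> real" where
  "elementary_process n \<tau> \<xi> u \<omega> = (\<Sum>i<n. \<xi> i \<omega> * indicator {\<tau> i<..\<tau> (Suc i)} u)"

definition elementary_integral ::
  "nat \<Rightarrow> (nat \<Rightarrow> real) \<Rightarrow> (nat \<Rightarrow> 'a \<Rightarrow> real) \<Rightarrow> (real \<Rightarrow> 'a \<Rightarrow> real) \<Rightarrow> 'a \<Rightarrow> real" where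
  "elementary_integral n \<tau> \<xi> B \<omega> = (\<Sum>i<n. \<xi> i \<omega> * (B (\<tau> (Suc i)) \<omega> - B (\<tau> i) \<omega>))"

text \<open>
  The Ito integral is determined only up to null sets, so it is a predicate:
  \<open>ito_integral M Fl B s t Y Z\<close> says that \<open>Z\<close> is a version of \<open>\<integral>\<^sub>s\<^sup>t Y\<^sub>u dB\<^sub>u\<close>, i.e. the mean-square limit of
  the integrals of elementary processes that approximate \<open>Y\<close> in mean square on \<open>[s, t]\<close>.
\<close>

definition ito_integral ::
  "'a measure \<Rightarrow> (real \<Rightarrow> 'a measure) \<Rightarrow> (real \<Rightarrow> 'a \<Rightarrow> real) \<Rightarrow> real \<Rightarrow> real
     \<Rightarrow> (real \<Rightarrow> 'a \<Rightarrow> real) \<Rightarrow> ('a \<Rightarrow> real) \<Rightarrow> bool" where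
  "ito_integral M Fl B s t Y Z \<longleftrightarrow>
     Z \<in> borel_measurable (Fl t) \<and>
     (\<lambda>(u, \<omega>). Y u \<omega>) \<in> borel_measurable (restrict_space borel {s..t} \<Otimes>\<^sub>M M) \<and>
     (\<exists>n \<tau> \<xi>.
        (\<forall>l. elementary_on Fl s t (n l) (\<tau> l) (\<xi> l)) \<and>
        (\<lambda>l. \<integral>\<^sup>+ \<omega>. (\<integral>\<^sup>+ u \<in> {s..t}.
              ennreal ((elementary_process (n l) (\<tau> l) (\<xi> l) u \<omega> - Y u \<omega>)\<^sup>2) \<partial>lborel) \<partial>M)
          \<longlonglongrightarrow> 0 \<and>
        (\<lambda>l. \<integral>\<^sup>+ \<omega>. ennreal ((elementary_integral (n l) (\<tau> l) (\<xi> l) B \<omega> - Z \<omega>)\<^sup>2) \<partial>M)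
          \<longlonglongrightarrow> 0)"

text \<open>\<open>Z\<close> is a version of \<open>\<integral>\<^sub>s\<^sup>t \<integral>\<^sub>s\<^sup>u dB1\<^sub>v dB2\<^sub>u\<close>.\<close>

definition iterated_ito_integral ::
  "'a measure \<Rightarrow> (real \<Rightarrow> 'a measure) \<Rightarrow> (real \<Rightarrow> 'a \<Rightarrow> real) \<Rightarrow> (real \<Rightarrow> 'a \<Rightarrow> real)
     \<Rightarrow> real \<Rightarrow> real \<Rightarrow> ('a \<Rightarrow> real) \<Rightarrow> bool" where
  "iterated_ito_integral M Fl B1 B2 s t Z \<longleftrightarrow>
     (\<exists>Y. (\<forall>u\<in>{s..t}. ito_integral M Fl B1 s u (\<lambda>_ _. 1) (Y u)) \<and>
          ito_integral M Fl B2 s t Y Z)"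

definition constraint_manifold ::
  "(real \<Rightarrow> real^'d^'d) \<Rightarrow> (real \<Rightarrow> real^'d \<Rightarrow> real^'d) \<Rightarrow> real \<Rightarrow> (real^'d) set" where
  "constraint_manifold A F t = {x. projR A t *v F t x = 0}"

text \<open>
  The recursion along one realisation: \<open>w\<close> is a path of the Brownian motion, \<open>I j1 j2 k\<close> the value of
  the iterated integral over \<open>[t\<^sub>k, t\<^sub>k\<^sub>+\<^sub>1]\<close>, where \<open>t\<^sub>k = k h\<close>. Only \<open>x 0, \<dots>, x K\<close> are constrained.
\<close>

definition theta_milstein ::
  "(real \<Rightarrow> real^'d^'d) \<Rightarrow> (real \<Rightarrow> real^'d \<Rightarrow> real^'d) \<Rightarrow> (real \<Rightarrow> real^'d \<Rightarrow> real^'m^'d)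
     \<Rightarrow> real^'d \<Rightarrow> real \<Rightarrow> real \<Rightarrow> nat \<Rightarrow> (real \<Rightarrow> real^'m) \<Rightarrow> ('m \<Rightarrow> 'm \<Rightarrow> nat \<Rightarrow> real)
     \<Rightarrow> (nat \<Rightarrow> real^'d) \<Rightarrow> bool" where
  "theta_milstein A F G X0 \<theta> h K w I x \<longleftrightarrow>
     x 0 = X0 \<and>
     (\<forall>k<K. let t = real k * h; t' = real (Suc k) * h in
        A t *v x (Suc k) =
          A t *v x k
          + (\<theta> * h) *\<^sub>R ((projR A t + A t ** mp_inverse (A t')) *v F t' (x (Suc k)))
          + ((1 - \<theta>) * h) *\<^sub>R F t (x k)
          + G t (x k) *v (w t' - w t)
          + (\<Sum>j1\<in>UNIV. \<Sum>j2\<in>UNIV. I j1 j2 k *\<^sub>R milstein_coeff A F G j1 j2 t (x k)))"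

lemma diag_first_mult:
  "diag_first r a ** diag_first r b =
     (diag_first r (\<lambda>i. a i * b i) :: real^('d::{finite,linorder})^('d::{finite,linorder}))"
proof -
  have "(\<Sum>k\<in>UNIV. diag_first r a $ i $ k * diag_first r b $ k $ j) = diag_first r (\<lambda>i. a i * b i) $ i $ j"
    for i j :: 'd
  proof -
    have "(\<Sum>k\<in>UNIV. diag_first r a $ i $ k * diag_first r b $ k $ j)
        = (\<Sum>k\<in>{i}. diag_first r a $ i $ k * diag_first r b $ k $ j)"
      by (rule sum.mono_neutral_right) (auto simp: diag_first_def)
    then show ?thesis
      by (auto simp: diag_first_def)
  qed
  then show ?thesis
    by (simp add: matrix_matrix_mult_def vec_eq_iff)
qed

lemma transpose_diag_first: "transpose (diag_first r a) = diag_first r a"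
  by (auto simp: transpose_def diag_first_def vec_eq_iff)

lemma coord_pos_ge_1: "1 \<le> coord_pos i"
  by (auto simp: coord_pos_def Suc_le_eq card_gt_0_iff)

lemma diag_first_cong: "(\<And>i. 1 \<le> i \<Longrightarrow> i \<le> r \<Longrightarrow> a i = b i) \<Longrightarrow> diag_first r a = diag_first r b"
  using coord_pos_ge_1 by (auto simp: diag_first_def vec_eq_iff)

lemma mp_inverse_svd:
  assumes U: "orthogonal_matrix U" and V: "orthogonal_matrix V"
    and s: "\<And>i. 1 \<le> i \<Longrightarrow> i \<le> r \<Longrightarrow> s i \<noteq> 0"
  defines "B \<equiv> U ** diag_first r s ** V"
    and "X \<equiv> transpose V ** diag_first r (\<lambda>i. 1 / s i) ** transpose U"
  shows "mp_inverse B = X"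
    and "B ** X = U ** diag_first r (\<lambda>_. 1) ** transpose U"
    and "X ** B = transpose V ** diag_first r (\<lambda>_. 1) ** V"
proof -
  let ?S = "diag_first r s" and ?T = "diag_first r (\<lambda>i. 1 / s i)" and ?E = "diag_first r (\<lambda>_. 1)"
  have ST: "?S ** ?T = ?E" "?T ** ?S = ?E"
    unfolding diag_first_mult using s by (auto intro!: diag_first_cong)
  have E: "?E ** ?S = ?S" "?E ** ?T = ?T"
    by (simp_all add: diag_first_mult)
  have can: "transpose U ** (U ** Z) = Z" "V ** (transpose V ** Z) = Z" for Z
    using U V by (simp_all add: matrix_mul_assoc orthogonal_matrix_def)
  have S': "?S ** (?T ** Z) = ?E ** Z" "?T ** (?S ** Z) = ?E ** Z"
    "?E ** (?S ** Z) = ?S ** Z" "?E ** (?T ** Z) = ?T ** Z" for Z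
    by (simp_all add: matrix_mul_assoc ST E)
  note r = matrix_mul_assoc[symmetric] can S' B_def X_def
  show BX: "B ** X = U ** ?E ** transpose U" and XB: "X ** B = transpose V ** ?E ** V"
    by (simp_all only: r)
  show "mp_inverse B = X"
  proof (rule mp_inverse_eqI, unfold is_mp_inverse_def,unfold BX XB, intro conjI)
    show "U ** ?E ** transpose U ** B = B" "transpose V ** ?E ** V ** X = X"
      by (simp_all only: r)
  qed (simp_all only: matrix_transpose_mul transpose_diag_first transpose_transpose matrix_mul_assoc)
qed

lemma projectors_constant:
  assumes "matrix_structure T A"
  obtains P R where "\<And>t. t \<in> {0..T} \<Longrightarrow> projP A t = P" "\<And>t. t \<in> {0..T} \<Longrightarrow> projR A t = R"
proof -
  from assms obtain U V r \<sigma> \<sigma>lo where U: "orthogonal_matrix U" and V: "orthogonal_matrix V"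
    and A: "\<And>t. t \<in> {0..T} \<Longrightarrow> A t = U ** diag_first r (\<lambda>i. \<sigma> i t) ** V"
    and lo: "0 < \<sigma>lo" "\<And>i t. i \<in> {1..r} \<Longrightarrow> t \<in> {0..T} \<Longrightarrow> \<sigma>lo \<le> \<sigma> i t"
    unfolding matrix_structure_def by metis
  have s: "\<sigma> i t \<noteq> 0" if "t \<in> {0..T}" "1 \<le> i" "i \<le> r" for i t
    using lo(1) lo(2)[of i t] that by auto
  show thesis
  proof (rule that)
    fix t assume t: "t \<in> {0..T}"
    note svd = mp_inverse_svd[OF U V s[OF t]]
    show "projP A t = transpose V ** diag_first r (\<lambda>_. 1) ** V"
      by (simp only: projP_def A[OF t] svd)
    show "projR A t = mat 1 - U ** diag_first r (\<lambda>_. 1) ** transpose U"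
      by (simp only: projR_def A[OF t] svd)
  qed
qed

end

theory Submission
  imports Defs
begin

text \<open>
  Consider one step, from \<open>t\<close> to \<open>t'\<close>, and write \<open>\<tau> = \<theta> \<Delta>\<close>. The recursion determines \<open>x'\<close> through an
  equation \<open>A\<^sub>t x' = \<xi> + \<tau> (R + A\<^sub>t A\<^sub>t\<^sub>'\<^sup>-) F(t', x')\<close>, where \<open>\<xi>\<close> collects the terms known at time \<open>t\<close>. Although
  \<open>A\<^sub>t\<close> is singular, \<open>R + A\<^sub>t A\<^sub>t\<^sub>'\<^sup>-\<close> is invertible with inverse \<open>R + A\<^sub>t\<^sub>' A\<^sub>t\<^sup>-\<close>, because the projectors \<open>P\<close> and \<open>R\<close> do
  not depend on time. Multiplication by the inverse gives the equivalent equation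
  \<open>\<Phi>(x') = (R + A\<^sub>t\<^sub>' A\<^sub>t\<^sup>-) \<xi>\<close> with \<open>\<Phi>(x) = A\<^sub>t\<^sub>' x - \<tau> F(t', x)\<close> (lemma \<open>theta_step_rewrite\<close>). So the scheme is well
  defined once \<open>\<Phi>\<close> is a bijection of \<open>\<real>\<^sup>d\<close>, and its solution is measurable once the inverse of \<open>\<Phi>\<close> is continuous.

  Both follow from an estimate \<open>|x - y| \<le> c |\<Phi>(x) - \<Phi>(y)|\<close>: a continuous map of \<open>\<real>\<^sup>d\<close> that satisfies it is injective,
  its range is closed by completeness and open by invariance of domain, and its inverse is Lipschitz
  (lemma \<open>expansive_imp_homeomorphism\<close>). The estimate has two ingredients.

  The index-1 hypothesis says that \<open>\<Psi>(x) = A x + R F(t', x)\<close> has derivative \<open>J\<close> with \<open>|J\<^sup>-\<^sup>1| \<le> L\<^sub>J\<close> everywhere. By a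
  theorem of Hadamard type (lemma \<open>inverse_derivative_bound_imp_expansive\<close>) this local information is global:
  \<open>|x - y| \<le> L\<^sub>J |\<Psi>(x) - \<Psi>(y)|\<close>. Since \<open>A = A P\<close> and \<open>R A = 0\<close>, the difference \<open>\<Psi>(x) - \<Psi>(y)\<close> equals
  \<open>A P (x - y) - \<tau>\<^sup>-\<^sup>1 R (\<Phi>(x) - \<Phi>(y))\<close>, so that \<open>|x - y|\<close> is at most
  \<open>L |P (x - y)| + D |\<Phi>(x) - \<Phi>(y)|\<close> with constants \<open>L = |A| L\<^sub>J\<close> and \<open>D\<close>: the component of \<open>x - y\<close> in the kernel of
  \<open>A\<close> is slaved to the other one.

  The monotonicity hypothesis controls \<open>P (x - y)\<close>. Pairing \<open>A\<^sup>- (\<Phi>(x) - \<Phi>(y)) = P (x - y) - \<tau> A\<^sup>- (F(x) - F(y))\<close> with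
  \<open>P (x - y)\<close> bounds \<open>|P (x - y)|\<^sup>2\<close> by \<open>\<tau> L\<^sub>1 |x - y|\<^sup>2 / 2\<close> plus a multiple of
  \<open>|P (x - y)| |\<Phi>(x) - \<Phi>(y)|\<close>. The step size restriction is what allows the first term to be absorbed after the
  bound on \<open>|x - y|\<close> has been inserted (lemma \<open>implicit_theta_map_expansive\<close>).

  For the constraint, multiply the recursion by \<open>R\<close>. It annihilates \<open>A\<^sub>t\<close> and \<open>G\<close>, hence also the derivatives of the
  columns of \<open>G\<close> and with them the Milstein terms, and leaves
  \<open>0 = (1 - \<theta>) \<Delta> R F(t, x) + \<theta> \<Delta> R F(t', x')\<close>; as \<open>\<theta> > 0\<close>, the constraint propagates from \<open>x\<close> to \<open>x'\<close>.
\<close>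

section \<open>Expansive maps of Euclidean space\<close>

text \<open>
  The range is open by invariance of domain. It is closed because preimages of a convergent sequence form a Cauchy
  sequence.
\<close>

lemma expansive_imp_surj:
  fixes f :: "'a::euclidean_space \<Rightarrow> 'a"
  assumes cont: "continuous_on UNIV f" and ex: "\<And>a b. dist a b \<le> L * dist (f a) (f b)"
  shows "surj f"
proof -
  have "inj f"
    using ex by (intro injI) (metis dist_eq_0_iff dist_le_zero_iff mult_zero_right)
  then have op: "open (range f)"
    by (intro invariance_of_domain cont) auto
  \<comment> \<open>The estimate also holds with the strictly positive constant \<open>\<bar>L\<bar> + 1\<close>, by which one can divide.\<close>
  have pos: "0 < \<bar>L\<bar> + 1" by simp
  have ex': "dist a b \<le> (\<bar>L\<bar> + 1) * dist (f a) (f b)" for a b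
    by (rule order_trans[OF ex]) (auto intro!: mult_right_mono)
  have "closed (range f)"
    unfolding closed_sequential_limits
  proof (intro allI impI, elim conjE)
    fix y l assume y: "\<forall>n. y n \<in> range f" and lim: "y \<longlonglongrightarrow> l"
    define x where "x n = inv f (y n)" for n
    have x: "y n = f (x n)" for n using y by (simp add: x_def f_inv_into_f)
    have "Cauchy x"
    proof (rule metric_CauchyI)
      fix e :: real assume "0 < e"
      then have "0 < e / (\<bar>L\<bar> + 1)" using pos by simp
      then obtain N where N: "\<And>m n. N \<le> m \<Longrightarrow> N \<le> n \<Longrightarrow> dist (y m) (y n) < e / (\<bar>L\<bar> + 1)"
        using metric_CauchyD[OF LIMSEQ_imp_Cauchy[OF lim]] by meson
      show "\<exists>N. \<forall>m\<ge>N. \<forall>n\<ge>N. dist (x m) (x n) < e"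
      proof (intro exI allI impI)
        fix m n assume "N \<le> m" "N \<le> n"
        from N[OF this] have "(\<bar>L\<bar> + 1) * dist (f (x m)) (f (x n)) < e"
          using pos unfolding x by (simp add: pos_less_divide_eq mult.commute)
        with ex'[of "x m" "x n"] show "dist (x m) (x n) < e" by linarith
      qed
    qed
    then obtain z where "x \<longlonglongrightarrow> z" using Cauchy_convergent convergent_def by blast
    then have "(\<lambda>n. f (x n)) \<longlonglongrightarrow> f z"
      using cont by (simp add: continuous_on_eq_continuous_at continuous_at_sequentially o_def)
    then have "l = f z" using lim unfolding x by (rule LIMSEQ_unique[rotated])
    then show "l \<in> range f" by simp
  qed
  with op show ?thesis using clopen[of "range f"] by auto
qed

lemma expansive_imp_homeomorphism:
  fixes f :: "'a::euclidean_space \<Rightarrow> 'a"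
  assumes "continuous_on UNIV f" and ex: "\<And>a b. dist a b \<le> c * dist (f a) (f b)"
  shows "bij f" and "continuous_on UNIV (inv f)"
proof -
  have "inj f"
    using ex by (intro injI) (metis dist_eq_0_iff dist_le_zero_iff mult_zero_right)
  with expansive_imp_surj[OF assms] show bij: "bij f" by (simp add: bij_def)
  have "dist (inv f y) (inv f z) \<le> \<bar>c\<bar> * dist y z" for y z
  proof -
    have "dist (inv f y) (inv f z) \<le> c * dist y z"
      using ex[of "inv f y" "inv f z"] bij by (simp add: bij_def surj_f_inv_f)
    also have "\<dots> \<le> \<bar>c\<bar> * dist y z" by (intro mult_right_mono) auto
    finally show ?thesis .
  qed
  then have "\<bar>c\<bar>-lipschitz_on UNIV (inv f)" by (intro lipschitz_onI) auto
  then show "continuous_on UNIV (inv f)" by (rule lipschitz_on_continuous_on)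
qed

text \<open>
  A quantitative local inverse: points on the sphere of radius \<open>r\<close> are mapped at least \<open>r / L\<close> away from \<open>f x\<close>. Hence,
  inside the ball of radius \<open>r / L\<close>, the image of the open ball (open by invariance of domain) coincides with the
  image of the closed ball (compact), and connectedness does the rest.
\<close>

lemma expansive_on_cball_covers_ball:
  fixes f :: "'a::euclidean_space \<Rightarrow> 'a"
  assumes cont: "continuous_on (cball x r) f" and "0 < r" "0 < L"
    and ex: "\<And>a b. a \<in> cball x r \<Longrightarrow> b \<in> cball x r \<Longrightarrow> dist a b \<le> L * dist (f a) (f b)"
    and y: "dist y (f x) < r / L"
  shows "\<exists>a\<in>ball x r. f a = y"
proof -
  let ?B = "ball (f x) (r / L)" and ?U = "f ` ball x r" and ?V = "f ` cball x r"
  have inj: "inj_on f (ball x r)"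
    using ex by (intro inj_onI) (metis ball_subset_cball dist_eq_0_iff dist_le_zero_iff mult_zero_right subsetD)
  have U: "open ?U"
    using continuous_on_subset[OF cont ball_subset_cball] inj by (intro invariance_of_domain) auto
  have V: "closed ?V"
    using cont by (intro compact_imp_closed compact_continuous_image) auto
  have "?B \<inter> ?V \<subseteq> ?U"
  proof clarify
    fix a assume a: "a \<in> cball x r" "f a \<in> ball (f x) (r / L)"
    have "dist x a \<le> L * dist (f x) (f a)" using ex[of x a] a \<open>0 < r\<close> by auto
    also have "\<dots> < r" using a \<open>0 < L\<close> by (simp add: pos_less_divide_eq mult.commute)
    finally show "f a \<in> ?U" by auto
  qed
  then have UV: "?B \<inter> ?U = ?B \<inter> ?V" by auto
  have "openin (top_of_set ?B) (?B \<inter> ?U)" using U by (simp add: openin_open_Int)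
  moreover have "closedin (top_of_set ?B) (?B \<inter> ?U)"
    unfolding UV using V by (simp add: closedin_closed_Int)
  moreover have "f x \<in> ?B \<inter> ?U" using \<open>0 < r\<close> \<open>0 < L\<close> by auto
  ultimately have "?B \<inter> ?U = ?B"
    using connected_clopen[THEN iffD1, OF connected_ball] by blast
  moreover have "y \<in> ?B" using y by (simp add: dist_commute)
  ultimately have "y \<in> f ` ball x r" by blast
  then show ?thesis by auto
qed

lemma locally_expansive_uniform:
  fixes f :: "'a::metric_space \<Rightarrow> 'b::metric_space"
  assumes loc: "\<And>x. \<exists>e>0. \<forall>a\<in>ball x e. \<forall>b\<in>ball x e. dist a b \<le> L * dist (f a) (f b)"
    and "compact S"
  obtains e where "0 < e"
    "\<And>x a b. x \<in> S \<Longrightarrow> a \<in> ball x e \<Longrightarrow> b \<in> ball x e \<Longrightarrow> dist a b \<le> L * dist (f a) (f b)"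
proof -
  obtain e where e: "\<And>x. 0 < e x"
    "\<And>x a b. a \<in> ball x (e x) \<Longrightarrow> b \<in> ball x (e x) \<Longrightarrow> dist a b \<le> L * dist (f a) (f b)"
    using loc by metis
  have "S \<subseteq> \<Union>(range (\<lambda>x. ball x (e x)))" using e(1) centre_in_ball by blast
  then obtain d where "0 < d" and d: "\<And>x. x \<in> S \<Longrightarrow> \<exists>B\<in>range (\<lambda>x. ball x (e x)). ball x d \<subseteq> B"
    by (rule Heine_Borel_lemma[OF \<open>compact S\<close>]) auto
  show thesis
  proof (rule that[OF \<open>0 < d\<close>])
    fix x a b assume "x \<in> S" "a \<in> ball x d" "b \<in> ball x d"
    then show "dist a b \<le> L * dist (f a) (f b)" using d[of x] e(2) by blast
  qed
qed

text \<open>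
  Over every ball around \<open>f x0\<close> there is a continuous section of \<open>f\<close> through \<open>x0\<close>. It is built by lifting the homotopy
  that inflates the constant \<open>f x0\<close> to the identity of the ball, \<open>y \<mapsto> f x0 + (k / n) (y - f x0)\<close> for \<open>k = 0, \<dots>, n\<close>.
  The Lipschitz bound along rays keeps all lifts in the compact ball of radius \<open>L R\<close> around \<open>x0\<close>, on which \<open>f\<close> is
  expansive at a uniform scale \<open>e\<close>; therefore one number \<open>n\<close> of steps serves all \<open>y\<close>.
\<close>

lemma locally_expansive_section:
  fixes f :: "'a::euclidean_space \<Rightarrow> 'a"
  assumes cont: "continuous_on UNIV f" and "0 < L"
    and loc: "\<And>x. \<exists>e>0. \<forall>a\<in>ball x e. \<forall>b\<in>ball x e. dist a b \<le> L * dist (f a) (f b)"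
  obtains s where "continuous_on (cball (f x0) R) s"
    "\<And>y. y \<in> cball (f x0) R \<Longrightarrow> f (s y) = y \<and> dist (s y) x0 \<le> L * dist y (f x0)"
proof -
  let ?y0 = "f x0" and ?D = "cball (f x0) R"
  obtain e where "0 < e" and e: "\<And>x a b. x \<in> cball x0 (L * R) \<Longrightarrow> a \<in> ball x e \<Longrightarrow> b \<in> ball x e
      \<Longrightarrow> dist a b \<le> L * dist (f a) (f b)"
    using locally_expansive_uniform[OF loc, of "cball x0 (L * R)"] by auto
  \<comment> \<open>Targets move by at most \<open>R / n < (e / 4) / L\<close> per step, so that each lift moves by less than \<open>e / 4\<close>.\<close>
  obtain n :: nat where n': "max 0 (4 * L * R / e) < real n"
    using reals_Archimedean2 by blast
  then have n: "4 * L * R / e < real n" "0 < n" by auto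
  have "\<exists>c. continuous_on ?D c \<and> (\<forall>y\<in>?D. f (c y) = ?y0 + (real k / real n) *\<^sub>R (y - ?y0)
      \<and> dist (c y) x0 \<le> L * (real k / real n) * dist y ?y0)" if "k \<le> n" for k
    using that
  proof (induction k)
    case 0
    then show ?case by (intro exI[of _ "\<lambda>_. x0"]) auto
  next
    case (Suc k)
    then obtain c where cc: "continuous_on ?D c"
      and c: "\<And>y. y \<in> ?D \<Longrightarrow> f (c y) = ?y0 + (real k / real n) *\<^sub>R (y - ?y0)"
      and cd: "\<And>y. y \<in> ?D \<Longrightarrow> dist (c y) x0 \<le> L * (real k / real n) * dist y ?y0"
      by fastforce
    define q where "q y = ?y0 + (real (Suc k) / real n) *\<^sub>R (y - ?y0)" for y
    have qc: "dist (q y) (f (c y)) = dist y ?y0 / n" if "y \<in> ?D" for y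
    proof -
      have "q y - f (c y) = (1 / real n) *\<^sub>R (y - ?y0)"
        unfolding q_def c[OF that] add_diff_cancel_left scaleR_diff_left[symmetric]
        by (simp add: diff_divide_distrib[symmetric])
      then show ?thesis by (simp add: dist_norm)
    qed
    have cx: "c y \<in> cball x0 (L * R)" if "y \<in> ?D" for y
    proof -
      have "L * (real k / real n) * dist y ?y0 \<le> L * 1 * R"
        using that \<open>0 < L\<close> Suc.prems by (intro mult_mono) (auto simp: dist_commute)
      with cd[OF that] show ?thesis by (simp add: dist_commute)
    qed
    have "\<exists>a\<in>ball (c y) (e / 4). f a = q y" if "y \<in> ?D" for y
    proof (rule expansive_on_cball_covers_ball)
      have "dist (q y) (f (c y)) \<le> R / n"
        using that by (auto simp: qc dist_commute intro: divide_right_mono)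
      also have "\<dots> < e / 4 / L"
        using n \<open>0 < e\<close> \<open>0 < L\<close> by (simp add: field_simps)
      finally show "dist (q y) (f (c y)) < e / 4 / L" .
      show "dist a b \<le> L * dist (f a) (f b)" if "a \<in> cball (c y) (e / 4)" "b \<in> cball (c y) (e / 4)" for a b
        using e[OF cx[OF \<open>y \<in> ?D\<close>], of a b] that \<open>0 < e\<close> by auto
    qed (use \<open>0 < e\<close> \<open>0 < L\<close> in \<open>auto intro: continuous_on_subset[OF cont]\<close>)
    then obtain c' where c': "\<And>y. y \<in> ?D \<Longrightarrow> c' y \<in> ball (c y) (e / 4)" "\<And>y. y \<in> ?D \<Longrightarrow> f (c' y) = q y"
      by metis
    have near: "dist (c' y) (c y) \<le> L * (dist y ?y0 / n)" if "y \<in> ?D" for y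
      using e[OF cx[OF that], of "c' y" "c y"] c'[OF that] \<open>0 < e\<close> qc[OF that]
      by (auto simp: mem_ball)
    \<comment> \<open>For \<open>y'\<close> close to \<open>y\<close>, both \<open>c' y\<close> and \<open>c' y'\<close> lie within \<open>e\<close> of \<open>c y\<close>, because
      \<open>c' y'\<close> is \<open>e / 4\<close>-close to \<open>c y'\<close> and \<open>c y'\<close> to \<open>c y\<close>. There \<open>f\<close> is expansive, so that
      continuity of the targets is inherited by their lifts.\<close>
    have "continuous_on ?D c'"
      unfolding continuous_on_iff
    proof (intro ballI allI impI)
      fix y and \<eta> :: real assume y: "y \<in> ?D" and "0 < \<eta>"
      have "0 < e / 4" using \<open>0 < e\<close> by simp
      then obtain d where d: "0 < d" "\<And>y'. y' \<in> ?D \<Longrightarrow> dist y' y < d \<Longrightarrow> dist (c y') (c y) < e / 4"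
        using cc y unfolding continuous_on_iff by meson
      show "\<exists>d>0. \<forall>y'\<in>?D. dist y' y < d \<longrightarrow> dist (c' y') (c' y) < \<eta>"
      proof (intro exI[of _ "min d (\<eta> / L)"] conjI ballI impI)
        show "0 < min d (\<eta> / L)" using d \<open>0 < \<eta>\<close> \<open>0 < L\<close> by simp
        fix y' assume y': "y' \<in> ?D" "dist y' y < min d (\<eta> / L)"
        have "dist (c' y') (c y) < e"
          using dist_triangle[of "c' y'" "c y" "c y'"] d(2)[of y'] y' c'(1)[of y'] \<open>0 < e\<close>
          by (simp add: dist_commute)
        then have "dist (c' y') (c' y) \<le> L * dist (q y') (q y)"
          using e[OF cx[OF y], of "c' y'" "c' y"] c'[OF y] c'(2)[of y'] y' \<open>0 < e\<close> by (simp add: dist_commute)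
        also have "dist (q y') (q y) = (real (Suc k) / real n) * dist y' y"
        proof -
          have "q y' - q y = (real (Suc k) / real n) *\<^sub>R (y' - y)"
            unfolding q_def add_diff_cancel_left scaleR_diff_right[symmetric] by simp
          then show ?thesis by (simp add: dist_norm del: of_nat_Suc)
        qed
        also have "L * ((real (Suc k) / real n) * dist y' y) \<le> L * (1 * dist y' y)"
          using Suc.prems \<open>0 < L\<close> by (intro mult_left_mono mult_right_mono) auto
        also have "\<dots> < \<eta>"
          using y' \<open>0 < L\<close> by (simp add: field_simps)
        finally show "dist (c' y') (c' y) < \<eta>" .
      qed
    qed
    moreover have "dist (c' y) x0 \<le> L * (real (Suc k) / real n) * dist y ?y0" if "y \<in> ?D" for y
      using dist_triangle[of "c' y" x0 "c y"] near[OF that] cd[OF that]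
      by (simp add: add_divide_distrib algebra_simps)
    ultimately show ?case using c'(2) by (intro exI[of _ c']) (auto simp: q_def)
  qed
  from this[of n] n show thesis using that by auto
qed

text \<open>
  Local expansivity with one constant is global. Take a section \<open>s\<close> through \<open>a\<close> over a ball that contains the image
  of the segment \<open>p\<close> from \<open>a\<close> to \<open>b\<close>. Then \<open>p\<close> and \<open>s \<circ> f \<circ> p\<close> are lifts of the same path with the same
  starting point. Their distance depends continuously on the parameter and cannot take small positive values, so it
  vanishes, that is, \<open>s (f b) = b\<close>; and \<open>s\<close> satisfies the required bound.
\<close>

theorem locally_expansive_imp_expansive:
  fixes f :: "'a::euclidean_space \<Rightarrow> 'a"
  assumes cont: "continuous_on UNIV f" and "0 < L"
    and loc: "\<And>x. \<exists>e>0. \<forall>a\<in>ball x e. \<forall>b\<in>ball x e. dist a b \<le> L * dist (f a) (f b)"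
  shows "dist a b \<le> L * dist (f a) (f b)"
proof -
  define p where "p t = a + t *\<^sub>R (b - a)" for t
  have p: "continuous_on {0..1} p" unfolding p_def by (intro continuous_intros)
  have fp: "continuous_on {0..1} (\<lambda>t. f (p t))"
    using continuous_on_compose2[OF cont p] by auto
  obtain R where R: "\<And>t. t \<in> {0..1} \<Longrightarrow> f (p t) \<in> cball (f a) R"
  proof -
    have "bounded ((\<lambda>t. f (p t)) ` {0..1})"
      by (rule compact_imp_bounded[OF compact_continuous_image[OF fp]]) simp
    then obtain R where "\<forall>y\<in>(\<lambda>t. f (p t)) ` {0..1}. dist (f a) y \<le> R"
      using bounded_any_center[of "(\<lambda>t. f (p t)) ` {0..1}" "f a"] by blast
    then show thesis by (intro that[of R]) auto
  qed
  obtain s where s: "continuous_on (cball (f a) R) s"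
    and fs: "\<And>y. y \<in> cball (f a) R \<Longrightarrow> f (s y) = y"
    and sd: "\<And>y. y \<in> cball (f a) R \<Longrightarrow> dist (s y) a \<le> L * dist y (f a)"
    using locally_expansive_section[OF cont \<open>0 < L\<close> loc, of a R] by metis
  obtain e where "0 < e" and e: "\<And>x u v. x \<in> p ` {0..1} \<Longrightarrow> u \<in> ball x e \<Longrightarrow> v \<in> ball x e
      \<Longrightarrow> dist u v \<le> L * dist (f u) (f v)"
    by (rule locally_expansive_uniform[OF loc, of "p ` {0..1}"]) (auto intro: compact_continuous_image[OF p])
  define d where "d t = dist (s (f (p t))) (p t)" for t
  have d: "continuous_on {0..1} d"
    unfolding d_def using R by (intro continuous_intros p continuous_on_compose2[OF s fp]) auto
  \<comment> \<open>Both arguments of \<open>d\<close> are preimages of \<open>f (p t)\<close>, and distinct preimages are at least \<open>e\<close> apart.\<close>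
  have gap: "d t = 0" if "t \<in> {0..1}" "d t < e" for t
    using e[of "p t" "s (f (p t))" "p t"] fs[OF R[OF that(1)]] that \<open>0 < e\<close>
    by (auto simp: d_def dist_commute)
  have "d 0 = 0"
    using sd[OF R[of 0]] by (simp add: d_def p_def)
  have "d 1 = 0"
  proof (rule ccontr)
    assume "d 1 \<noteq> 0"
    then have "e \<le> d 1" using gap[of 1] by force
    then obtain t where "0 \<le> t" "t \<le> 1" "d t = e / 2"
      using IVT'[of d 0 "e / 2" 1] \<open>d 0 = 0\<close> \<open>0 < e\<close> d by auto
    then show False using gap[of t] \<open>0 < e\<close> by auto
  qed
  then have "s (f b) = b" by (simp add: d_def p_def)
  then show ?thesis
    using sd[OF R[of 1]] by (simp add: p_def dist_commute)
qed

section \<open>Matrices and their inverses\<close>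

lemma norm_matrix_vector_mult_le:
  fixes B :: "real^'n^'m"
  shows "norm (B *v x) \<le> norm B * norm x"
proof -
  have "norm (B *v x) = L2_set (\<lambda>i. \<bar>B $ i \<bullet> x\<bar>) UNIV"
    by (simp add: norm_vec_def matrix_vector_mul_component)
  also have "\<dots> \<le> L2_set (\<lambda>i. norm (B $ i) * norm x) UNIV"
    by (intro L2_set_mono Cauchy_Schwarz_ineq2) auto
  also have "\<dots> = norm B * norm x"
    unfolding norm_vec_def[of B] by (rule L2_set_left_distrib[symmetric]) simp
  finally show ?thesis .
qed

lemma continuous_on_matrix_vector_mult:
  fixes B :: "'x::topological_space \<Rightarrow> real^'n^'m"
  assumes "continuous_on S B" "continuous_on S v"
  shows "continuous_on S (\<lambda>x. B x *v v x)"
  unfolding matrix_vector_mult_def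
  by (intro continuous_on_vec_lambda continuous_intros assms)

lemma continuous_on_matrix_matrix_mult:
  fixes B :: "'x::topological_space \<Rightarrow> real^'n^'m" and C :: "'x \<Rightarrow> real^'k^'n"
  assumes "continuous_on S B" "continuous_on S C"
  shows "continuous_on S (\<lambda>x. B x ** C x)"
  unfolding matrix_matrix_mult_def
  by (intro continuous_on_vec_lambda continuous_intros assms)

lemma matrix_inv_mult_vector:
  fixes B :: "real^'n^'n"
  assumes "invertible B"
  shows "matrix_inv B *v (B *v x) = x" "B *v (matrix_inv B *v x) = x"
proof -
  have "B ** matrix_inv B = mat 1 \<and> matrix_inv B ** B = mat 1"
    using assms unfolding invertible_def matrix_inv_def by (rule someI_ex)
  then show "matrix_inv B *v (B *v x) = x" "B *v (matrix_inv B *v x) = x"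
    by (simp_all add: matrix_vector_mul_assoc)
qed

text \<open>
  With \<open>z = J(x)\<^sup>-\<^sup>1 g(x)\<close> fixed, \<open>J(y)\<^sup>-\<^sup>1 g(y) - z = J(y)\<^sup>-\<^sup>1 (g(y) - J(y) z)\<close>, and the right-hand side tends to
  \<open>0\<close> as \<open>y \<rightarrow> x\<close> because the inverses stay bounded.
\<close>

lemma continuous_on_matrix_inv_mult:
  fixes J :: "real^'n \<Rightarrow> real^'n^'n" and g :: "real^'n \<Rightarrow> real^'n"
  assumes J: "continuous_on UNIV J" and g: "continuous_on UNIV g"
    and inv: "\<And>x. invertible (J x)" and bound: "\<And>x. norm (matrix_inv (J x)) \<le> C"
  shows "continuous_on UNIV (\<lambda>x. matrix_inv (J x) *v g x)"
  unfolding continuous_on_def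
proof
  fix x :: "real^'n"
  define z where "z = matrix_inv (J x) *v g x"
  have "continuous_on UNIV (\<lambda>y. C * norm (g y - J y *v z))"
    by (intro continuous_intros continuous_on_matrix_vector_mult J g)
  then have "((\<lambda>y. C * norm (g y - J y *v z)) \<longlongrightarrow> C * norm (g x - J x *v z)) (at x)"
    unfolding continuous_on_def by auto
  moreover have "g x - J x *v z = 0"
    by (simp add: z_def matrix_inv_mult_vector inv)
  ultimately have lim: "((\<lambda>y. C * norm (g y - J y *v z)) \<longlongrightarrow> 0) (at x)" by simp
  have "norm (matrix_inv (J y) *v g y - z) \<le> C * norm (g y - J y *v z)" for y
  proof -
    have "matrix_inv (J y) *v g y - z = matrix_inv (J y) *v (g y - J y *v z)"
      by (simp add: matrix_vector_mult_diff_distrib matrix_inv_mult_vector inv)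
    then show ?thesis
      using order_trans[OF norm_matrix_vector_mult_le mult_right_mono[OF bound norm_ge_zero]] by metis
  qed
  then have "((\<lambda>y. matrix_inv (J y) *v g y - z) \<longlongrightarrow> 0) (at x)"
    by (intro Lim_null_comparison[OF _ lim]) auto
  then show "((\<lambda>y. matrix_inv (J y) *v g y) \<longlongrightarrow> matrix_inv (J x) *v g x) (at x within UNIV)"
    unfolding z_def by (simp add: LIM_zero_iff)
qed

text \<open>
  Near \<open>x\<close> the map \<open>f\<close> differs from its linearisation by a map with small Lipschitz constant, so that it is locally
  expansive with any constant \<open>L > C\<close>. The passage from local to global keeps \<open>L\<close>, and then \<open>L\<close> decreases to \<open>C\<close>.
\<close>

theorem inverse_derivative_bound_imp_expansive:
  fixes f :: "real^'n \<Rightarrow> real^'n" and J :: "real^'n \<Rightarrow> real^'n^'n"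
  assumes der: "\<And>x. (f has_derivative (*v) (J x)) (at x)"
    and J: "continuous_on UNIV J"
    and inv: "\<And>x. invertible (J x)" and bound: "\<And>x. norm (matrix_inv (J x)) \<le> C"
    and "0 < C"
  shows "dist a b \<le> C * dist (f a) (f b)"
proof -
  have cont: "continuous_on UNIV f"
    using der by (meson continuous_at_imp_continuous_on has_derivative_continuous)
  have local: "\<exists>e>0. \<forall>a\<in>ball x e. \<forall>b\<in>ball x e. dist a b \<le> L * dist (f a) (f b)" if "C < L" for x L
  proof -
    \<comment> \<open>This \<open>\<eta>\<close> is the largest perturbation of the derivative for which
      \<open>|a - b| \<le> C (|f a - f b| + \<eta> |a - b|)\<close> still yields the constant \<open>L\<close>: \<open>1 - C \<eta> = C / L\<close>.\<close>
    define \<eta> where "\<eta> = 1 / C - 1 / L"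
    have "0 < \<eta>" using \<open>0 < C\<close> \<open>C < L\<close> by (simp add: \<eta>_def frac_less2)
    then obtain e where "0 < e" and e: "\<And>z. z \<in> ball x e \<Longrightarrow> norm (J z - J x) < \<eta>"
      using J unfolding continuous_on_iff dist_norm mem_ball by (metis UNIV_I norm_minus_commute)
    show ?thesis
    proof (intro exI conjI ballI)
      fix a b assume ab: "a \<in> ball x e" "b \<in> ball x e"
      have "norm ((f a - J x *v a) - (f b - J x *v b)) \<le> \<eta> * norm (a - b)"
      proof (rule differentiable_bound[OF convex_ball])
        fix z assume z: "z \<in> ball x e"
        have "((\<lambda>y. f y - J x *v y) has_derivative (\<lambda>h. J z *v h - J x *v h)) (at z)"
          by (intro derivative_intros der bounded_linear_imp_has_derivative) auto
        then show "((\<lambda>y. f y - J x *v y) has_derivative (\<lambda>h. J z *v h - J x *v h)) (at z within ball x e)"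
          by (rule has_derivative_at_withinI)
        show "onorm (\<lambda>h. J z *v h - J x *v h) \<le> \<eta>"
        proof (rule onorm_le)
          fix h
          have "norm ((J z - J x) *v h) \<le> norm (J z - J x) * norm h"
            by (rule norm_matrix_vector_mult_le)
          also have "\<dots> \<le> \<eta> * norm h"
            using e[OF z] by (intro mult_right_mono) auto
          finally show "norm (J z *v h - J x *v h) \<le> \<eta> * norm h"
            by (simp add: matrix_vector_mult_diff_rdistrib)
        qed
      qed (use ab in auto)
      moreover have "norm (J x *v (a - b)) \<le> norm (f a - f b) + norm ((f a - J x *v a) - (f b - J x *v b))"
        using norm_triangle_ineq4[of "f a - f b" "(f a - J x *v a) - (f b - J x *v b)"]
        by (simp add: matrix_vector_mult_diff_distrib)
      ultimately have *: "norm (J x *v (a - b)) \<le> norm (f a - f b) + \<eta> * norm (a - b)" by linarith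
      have "norm (a - b) = norm (matrix_inv (J x) *v (J x *v (a - b)))"
        by (simp only: matrix_inv_mult_vector[OF inv])
      also have "\<dots> \<le> C * norm (J x *v (a - b))"
        by (rule order_trans[OF norm_matrix_vector_mult_le]) (intro mult_right_mono bound norm_ge_zero)
      also have "\<dots> \<le> C * (norm (f a - f b) + \<eta> * norm (a - b))"
        using * \<open>0 < C\<close> by (intro mult_left_mono) auto
      also have "\<dots> = C * norm (f a - f b) + norm (a - b) - C / L * norm (a - b)"
        using \<open>0 < C\<close> by (simp add: \<eta>_def algebra_simps)
      finally have "C * (norm (a - b) / L) \<le> C * norm (f a - f b)" by simp
      then show "dist a b \<le> L * dist (f a) (f b)"
        using \<open>0 < C\<close> \<open>C < L\<close> by (simp add: dist_norm pos_divide_le_eq mult.commute)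
    qed fact
  qed
  show ?thesis
  proof (rule field_le_epsilon)
    fix \<epsilon> :: real assume "0 < \<epsilon>"
    define L where "L = C + \<epsilon> / (dist (f a) (f b) + 1)"
    have pos: "0 < dist (f a) (f b) + 1" by (rule add_nonneg_pos) auto
    then have "C < L" using \<open>0 < \<epsilon>\<close> by (simp add: L_def)
    have "dist a b \<le> L * dist (f a) (f b)"
      using \<open>0 < C\<close> \<open>C < L\<close> by (intro locally_expansive_imp_expansive[OF cont] local) auto
    also have "\<dots> = C * dist (f a) (f b) + \<epsilon> * (dist (f a) (f b) / (dist (f a) (f b) + 1))"
      by (simp add: L_def algebra_simps)
    also have "\<dots> \<le> C * dist (f a) (f b) + \<epsilon> * 1"
      using \<open>0 < \<epsilon>\<close> pos by (intro add_left_mono mult_left_mono) auto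
    finally show "dist a b \<le> C * dist (f a) (f b) + \<epsilon>" by simp
  qed
qed

section \<open>The implicit map of a theta step\<close>

text \<open>
  The matrix \<open>A' B + (1 - A B)\<close> is invertible, with inverse \<open>A B' + (1 - A B)\<close>, and maps \<open>A v\<close> to \<open>A' v\<close>.
  Here \<open>B\<close> and \<open>B'\<close> stand for the Moore--Penrose inverses of two matrices \<open>A\<close> and \<open>A'\<close> with the same projectors.
\<close>

lemma theta_step_rewrite:
  fixes A A' B B' :: "real^'n^'n"
  assumes A: "A ** B ** A = A" and A': "A' ** B' ** A' = A'" "B' ** A' ** B' = B'"
    and P: "B' ** A' = B ** A" and Q: "A' ** B' = A ** B" and B: "B ** A ** B = B"
  shows "A *v x = \<xi> + \<tau> *\<^sub>R (((mat 1 - A ** B) + A ** B') *v f)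
     \<longleftrightarrow> A' *v x - \<tau> *\<^sub>R f = (A' ** B + (mat 1 - A ** B)) *v \<xi>"
    (is "?l \<longleftrightarrow> ?r")
proof -
  define N where "N = A' ** B + (mat 1 - A ** B)"
  define N' where "N' = A ** B' + (mat 1 - A ** B)"
  have red: "A *v (B *v (A *v v)) = A *v v" "B *v (A *v (B *v v)) = B *v v"
    "A' *v (B' *v v) = A *v (B *v v)" "B' *v (A' *v v) = B *v (A *v v)"
    "B' *v (A *v (B *v v)) = B' *v v" "A' *v (B *v (A *v v)) = A' *v v"
    "A *v (B *v (A' *v v)) = A' *v v" "B *v (A *v (B' *v v)) = B' *v v" for v
    using assms by (metis matrix_vector_mul_assoc)+
  have N: "N *v v = A' *v (B *v v) + (v - A *v (B *v v))"
    and N': "N' *v v = A *v (B' *v v) + (v - A *v (B *v v))" for v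
    by (simp_all add: N_def N'_def matrix_vector_mult_add_rdistrib matrix_vector_mult_diff_rdistrib
        matrix_vector_mul_assoc)
  have inv: "N *v (N' *v v) = v" "N' *v (N *v v) = v" for v
    unfolding N N' matrix_vector_right_distrib matrix_vector_mult_diff_distrib red by simp_all
  have NA: "N *v (A *v v) = A' *v v" for v
    unfolding N red by simp
  have "?l \<longleftrightarrow> A *v x - \<tau> *\<^sub>R (N' *v f) = \<xi>"
    unfolding N'_def by (auto simp: algebra_simps)
  also have "\<dots> \<longleftrightarrow> N *v (A *v x - \<tau> *\<^sub>R (N' *v f)) = N *v \<xi>"
    using inv by metis
  also have "\<dots> \<longleftrightarrow> A' *v x - \<tau> *\<^sub>R f = N *v \<xi>"
    by (simp add: matrix_vector_mult_diff_distrib matrix_vector_mult_scaleR NA inv)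
  finally show ?thesis unfolding N_def .
qed

text \<open>
  The proof works with the differences \<open>w = x - y\<close>, \<open>g = f x - f y\<close>, \<open>u = P w\<close> for the projector \<open>P = B A\<close>, and \<open>\<delta>\<close>,
  the difference of the images. The hypothesis on \<open>A x + R f(x)\<close> bounds \<open>w\<close> by \<open>u\<close> and \<open>\<delta>\<close>, because \<open>R A = 0\<close>
  turns \<open>R g\<close> into \<open>- R \<delta> / \<tau>\<close>. The monotonicity hypothesis then bounds \<open>u\<close> by \<open>\<delta>\<close>.
\<close>

lemma implicit_theta_map_expansive:
  fixes A B :: "real^'n^'n" and f :: "real^'n \<Rightarrow> real^'n"
  defines "R \<equiv> mat 1 - A ** B"
  assumes A: "A ** B ** A = A"
    and J: "\<And>x y. dist x y \<le> C * dist (A *v x + R *v f x) (A *v y + R *v f y)"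
    and mono: "\<And>x y. 2 * (((B ** A) *v x - (B ** A) *v y) \<bullet> (B *v f x - B *v f y)) \<le> L1 * (norm (x - y))\<^sup>2"
    and "0 < \<tau>" "0 < C" "0 < L1" and small: "4 * \<tau> * L1 * (1 + L\<^sup>2) \<le> 1" and L: "norm A * C \<le> L"
  obtains c where "\<And>x y. dist x y \<le> c * dist (A *v x - \<tau> *\<^sub>R f x) (A *v y - \<tau> *\<^sub>R f y)"
proof
  define D where "D = C * norm R / \<tau>"
  define s where "s = sqrt (D\<^sup>2 / 2 + 2 * (norm B)\<^sup>2)"
  fix x y :: "real^'n"
  define w where "w = x - y"
  define g where "g = f x - f y"
  define \<delta> where "\<delta> = A *v w - \<tau> *\<^sub>R g"
  define u where "u = B *v (A *v w)"
  have "0 \<le> D" using \<open>0 < C\<close> \<open>0 < \<tau>\<close> by (simp add: D_def)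
  have RA: "R *v (A *v v) = 0" for v
    unfolding R_def matrix_vector_mult_diff_rdistrib by (simp add: matrix_vector_mul_assoc A)
  have Rg: "R *v g = - (1 / \<tau>) *\<^sub>R (R *v \<delta>)"
    using \<open>0 < \<tau>\<close> by (simp add: \<delta>_def matrix_vector_mult_diff_distrib matrix_vector_mult_scaleR RA)
  have Aw: "A *v w = A *v u"
    by (simp only: u_def matrix_vector_mul_assoc matrix_mul_assoc A)
  have "norm w \<le> C * norm (A *v w + R *v g)"
    using J[of x y] by (simp add: dist_norm w_def g_def matrix_vector_mult_diff_distrib algebra_simps)
  also have "\<dots> \<le> C * (norm A * norm u + norm (R *v \<delta>) / \<tau>)"
  proof (rule mult_left_mono)
    have "norm (A *v w + R *v g) \<le> norm (A *v u) + norm (R *v g)"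
      unfolding Aw by (rule norm_triangle_ineq)
    also have "norm (R *v g) = norm (R *v \<delta>) / \<tau>"
      using \<open>0 < \<tau>\<close> by (simp add: Rg)
    finally show "norm (A *v w + R *v g) \<le> norm A * norm u + norm (R *v \<delta>) / \<tau>"
      using norm_matrix_vector_mult_le[of A u] by linarith
  qed (use \<open>0 < C\<close> in auto)
  also have "\<dots> \<le> C * (norm A * norm u + norm R * norm \<delta> / \<tau>)"
    using \<open>0 < C\<close> \<open>0 < \<tau>\<close> norm_matrix_vector_mult_le[of R \<delta>]
    by (intro mult_left_mono add_left_mono divide_right_mono) auto
  also have "\<dots> \<le> L * norm u + D * norm \<delta>"
    using mult_right_mono[OF L norm_ge_zero[of u]] by (simp add: D_def algebra_simps)
  finally have w: "norm w \<le> L * norm u + D * norm \<delta>" .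
  \<comment> \<open>The step size condition gives both \<open>\<tau> L1 L\<^sup>2 \<le> 1 / 4\<close> and \<open>\<tau> L1 \<le> 1 / 4\<close>.\<close>
  have w2: "\<tau> * L1 / 2 * (norm w)\<^sup>2 \<le> (norm u)\<^sup>2 / 4 + D\<^sup>2 * (norm \<delta>)\<^sup>2 / 4"
  proof -
    have \<tau>L: "0 \<le> \<tau> * L1" using \<open>0 < \<tau>\<close> \<open>0 < L1\<close> by simp
    have *: "\<tau> * L1 + \<tau> * L1 * L\<^sup>2 \<le> 1 / 4"
      using small by (simp add: algebra_simps)
    have l1: "\<tau> * L1 \<le> 1 / 4" and l2: "\<tau> * L1 * L\<^sup>2 \<le> 1 / 4"
      using * \<tau>L mult_nonneg_nonneg[OF \<tau>L zero_le_power2[of L]] by linarith+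
    have "(norm w)\<^sup>2 \<le> (L * norm u + D * norm \<delta>)\<^sup>2"
      using w by (intro power_mono) auto
    also have "\<dots> \<le> 2 * (L * norm u)\<^sup>2 + 2 * (D * norm \<delta>)\<^sup>2"
      using zero_le_power2[of "L * norm u - D * norm \<delta>"] by (simp add: power2_eq_square algebra_simps)
    finally have "\<tau> * L1 / 2 * (norm w)\<^sup>2 \<le> \<tau> * L1 / 2 * (2 * (L * norm u)\<^sup>2 + 2 * (D * norm \<delta>)\<^sup>2)"
      using \<tau>L by (intro mult_left_mono) auto
    also have "\<dots> = (\<tau> * L1 * L\<^sup>2) * (norm u)\<^sup>2 + \<tau> * L1 * (D\<^sup>2 * (norm \<delta>)\<^sup>2)"
      by (simp add: power_mult_distrib algebra_simps)
    also have "\<dots> \<le> 1 / 4 * (norm u)\<^sup>2 + 1 / 4 * (D\<^sup>2 * (norm \<delta>)\<^sup>2)"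
      by (intro add_mono mult_right_mono l1 l2) auto
    finally show ?thesis by simp
  qed
  \<comment> \<open>Pair \<open>B \<delta> = u - \<tau> B g\<close> with \<open>u\<close>. Each of the two terms costs a quarter of \<open>|u|\<^sup>2\<close>, and half of it
    remains.\<close>
  have "(norm u)\<^sup>2 = u \<bullet> (B *v \<delta>) + \<tau> * (u \<bullet> (B *v g))"
    by (simp add: \<delta>_def matrix_vector_mult_diff_distrib matrix_vector_mult_scaleR inner_diff_right
        power2_norm_eq_inner flip: u_def)
  moreover have "u \<bullet> (B *v g) \<le> L1 / 2 * (norm w)\<^sup>2"
    using mono[of x y]
    by (simp add: u_def g_def w_def matrix_vector_mult_diff_distrib matrix_vector_mul_assoc)
  then have "\<tau> * (u \<bullet> (B *v g)) \<le> \<tau> * (L1 / 2 * (norm w)\<^sup>2)"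
    using \<open>0 < \<tau>\<close> by (intro mult_left_mono) auto
  then have "\<tau> * (u \<bullet> (B *v g)) \<le> \<tau> * L1 / 2 * (norm w)\<^sup>2" by simp
  moreover have "u \<bullet> (B *v \<delta>) \<le> (norm u)\<^sup>2 / 4 + (norm B)\<^sup>2 * (norm \<delta>)\<^sup>2"
  proof -
    have "u \<bullet> (B *v \<delta>) \<le> norm u * norm (B *v \<delta>)" by (rule norm_cauchy_schwarz)
    also have "\<dots> \<le> norm u * (norm B * norm \<delta>)"
      by (intro mult_left_mono norm_matrix_vector_mult_le) auto
    also have "\<dots> \<le> (norm u)\<^sup>2 / 4 + (norm B * norm \<delta>)\<^sup>2"
      using zero_le_power2[of "norm u / 2 - norm B * norm \<delta>"]
      by (simp add: power2_eq_square algebra_simps)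
    finally show ?thesis by (simp add: power_mult_distrib)
  qed
  ultimately have "(norm u)\<^sup>2 \<le> (D\<^sup>2 / 2 + 2 * (norm B)\<^sup>2) * (norm \<delta>)\<^sup>2"
    using w2 unfolding distrib_right times_divide_eq_left mult.assoc by linarith
  also have "\<dots> = (s * norm \<delta>)\<^sup>2"
    by (simp add: s_def power_mult_distrib)
  finally have u: "norm u \<le> s * norm \<delta>"
    by (rule power2_le_imp_le) (simp add: s_def)
  have "0 \<le> L" using L \<open>0 < C\<close> by (meson less_imp_le mult_nonneg_nonneg norm_ge_zero order_trans)
  with u have "L * norm u \<le> L * (s * norm \<delta>)" by (intro mult_left_mono)
  with w have "norm w \<le> (L * s + D) * norm \<delta>" by (simp add: algebra_simps)
  moreover have "\<delta> = (A *v x - \<tau> *\<^sub>R f x) - (A *v y - \<tau> *\<^sub>R f y)"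
    by (simp add: \<delta>_def w_def g_def algebra_simps)
  ultimately show "dist x y \<le> (L * s + D) * dist (A *v x - \<tau> *\<^sub>R f x) (A *v y - \<tau> *\<^sub>R f y)"
    by (simp add: dist_norm w_def)
qed

section \<open>Consequences of the structural hypotheses\<close>

text \<open>
  The Moore--Penrose inverse is defined by a definite description, so its defining equations hold only once a solution
  is at hand; here the singular value decomposition provides one.
\<close>

lemma matrix_structure_is_mp_inverse:
  assumes "matrix_structure T A" and t: "t \<in> {0..T}"
  shows "is_mp_inverse (A t) (mp_inverse (A t))"
proof -
  from assms(1) obtain U V r \<sigma> \<sigma>lo where U: "orthogonal_matrix U" and V: "orthogonal_matrix V"
    and A: "\<And>t. t \<in> {0..T} \<Longrightarrow> A t = U ** diag_first r (\<lambda>i. \<sigma> i t) ** V"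
    and lo: "0 < \<sigma>lo" "\<And>i t. i \<in> {1..r} \<Longrightarrow> t \<in> {0..T} \<Longrightarrow> \<sigma>lo \<le> \<sigma> i t"
    unfolding matrix_structure_def by metis
  have s: "\<sigma> i t \<noteq> 0" if "1 \<le> i" "i \<le> r" for i
    using lo(1) lo(2)[of i t] that t by auto
  let ?S = "diag_first r (\<lambda>i. \<sigma> i t)" and ?T = "diag_first r (\<lambda>i. 1 / \<sigma> i t)" and ?E = "diag_first r (\<lambda>_. 1)"
  have can: "transpose U ** (U ** Z) = Z" "V ** (transpose V ** Z) = Z" for Z
    using U V by (simp_all add: matrix_mul_assoc orthogonal_matrix_def)
  have E: "?E ** (?S ** Z) = ?S ** Z" "?E ** (?T ** Z) = ?T ** Z" for Z
    by (simp_all add: matrix_mul_assoc diag_first_mult)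
  have inv: "mp_inverse (A t) = transpose V ** ?T ** transpose U"
    unfolding A[OF t] by (rule mp_inverse_svd(1)[OF U V]) (rule s)
  have AX: "A t ** mp_inverse (A t) = U ** ?E ** transpose U"
    unfolding inv unfolding A[OF t] by (rule mp_inverse_svd(2)[OF U V]) (rule s)
  have XA: "mp_inverse (A t) ** A t = transpose V ** ?E ** V"
    unfolding inv unfolding A[OF t] by (rule mp_inverse_svd(3)[OF U V]) (rule s)
  show ?thesis
    unfolding is_mp_inverse_def
  proof (unfold AX XA, intro conjI)
    show "U ** ?E ** transpose U ** A t = A t"
      by (simp only: A[OF t] matrix_mul_assoc[symmetric] can E)
    show "transpose V ** ?E ** V ** mp_inverse (A t) = mp_inverse (A t)"
      by (simp only: inv matrix_mul_assoc[symmetric] can E)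
  qed (simp_all only: matrix_transpose_mul transpose_diag_first transpose_transpose matrix_mul_assoc)
qed

text \<open>
  A supremum of reals is an upper bound only for a set that is bounded above. Boundedness comes from the continuity of
  the singular values on the compact interval.
\<close>

lemma matrix_structure_norm_le_SUP:
  fixes A :: "real \<Rightarrow> real^('d::{finite,linorder})^('d::{finite,linorder})"
  assumes "matrix_structure T A" and t: "t \<in> {0..T}"
  shows "norm (A t) \<le> (SUP t\<in>{0..T}. norm (A t))"
proof (rule cSUP_upper[OF t])
  from assms(1) obtain U V :: "real^('d::{finite,linorder})^('d::{finite,linorder})" and r \<sigma> \<sigma>' where
    A: "\<forall>t\<in>{0..T}. A t = U ** diag_first r (\<lambda>i. \<sigma> i t) ** V"
    and der: "\<And>i t. i \<in> {1..r} \<Longrightarrow> t \<in> {0..T} \<Longrightarrow> (\<sigma> i has_real_derivative \<sigma>' i t) (at t within {0..T})"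
    unfolding matrix_structure_def by metis
  have "continuous_on {0..T} (\<lambda>t. (diag_first r (\<lambda>i. \<sigma> i t) :: real^('d::{finite,linorder})^('d::{finite,linorder})) $ i $ j)" for i j :: 'd
  proof -
    have entry: "(\<lambda>t. (diag_first r (\<lambda>i. \<sigma> i t) :: real^('d::{finite,linorder})^('d::{finite,linorder})) $ i $ j)
        = (if i = j \<and> coord_pos i \<le> r then \<sigma> (coord_pos i) else (\<lambda>_. 0))"
      by (auto simp: diag_first_def)
    have "continuous_on {0..T} (\<sigma> (coord_pos i))" if "coord_pos i \<le> r"
      by (rule DERIV_continuous_on) (use der[of "coord_pos i"] coord_pos_ge_1[of i] that in auto)
    then show ?thesis unfolding entry by auto
  qed
  then have "continuous_on {0..T} (\<lambda>t. \<chi> i j. (diag_first r (\<lambda>i. \<sigma> i t)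
      :: real^('d::{finite,linorder})^('d::{finite,linorder})) $ i $ j)"
    by (intro continuous_on_vec_lambda)
  then have "continuous_on {0..T} (\<lambda>t. U ** diag_first r (\<lambda>i. \<sigma> i t) ** V)"
    by (intro continuous_on_matrix_matrix_mult continuous_on_const) simp
  then have "continuous_on {0..T} A"
    by (rule continuous_on_eq) (simp add: A)
  then have "continuous_on {0..T} (\<lambda>t. norm (A t))"
    by (rule continuous_on_norm)
  then have "compact ((\<lambda>t. norm (A t)) ` {0..T})"
    by (rule compact_continuous_image) simp
  then show "bdd_above ((\<lambda>t. norm (A t)) ` {0..T})"
    by (intro bounded_imp_bdd_above compact_imp_bounded)
qed

lemma C12_slice:
  fixes f :: "real \<Rightarrow> real^'d \<Rightarrow> real^'d"
  assumes "C12 T f" and t: "t \<in> {0..T}"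
  shows "continuous_on UNIV (f t)" "continuous_on UNIV (Dx f t)" "f t differentiable (at x)"
proof -
  have slice: "continuous_on UNIV (\<lambda>x. (t, x))" "range (\<lambda>x::real^'d. (t, x)) \<subseteq> {0..T} \<times> UNIV"
    using t by (auto intro: continuous_intros)
  have "continuous_on ({0..T} \<times> UNIV) (\<lambda>(t, x). f t x)" "continuous_on ({0..T} \<times> UNIV) (\<lambda>(t, x). Dx f t x)"
    using assms(1) unfolding C12_def by blast+
  from this[THEN continuous_on_compose2, OF slice]
  show "continuous_on UNIV (f t)" "continuous_on UNIV (Dx f t)" by simp_all
  show "f t differentiable (at x)"
    using assms unfolding C12_def by blast
qed

lemma continuous_on_Jmat:
  assumes "C12 T F" and "t \<in> {0..T}"
  shows "continuous_on UNIV (Jmat A F t)"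
proof -
  have "continuous_on UNIV (\<lambda>x. A t + projR A t ** Dx F t x)"
    by (intro continuous_on_add continuous_on_const continuous_on_matrix_matrix_mult C12_slice(2)[OF assms])
  then show ?thesis unfolding Jmat_def[abs_def] .
qed

lemma continuous_on_milstein_coeff:
  assumes "index_one T A F G X0 LJ" and "C12 T F" "\<And>j. C12 T (gcol G j)" and "t \<in> {0..T}"
  shows "continuous_on UNIV (milstein_coeff A F G j1 j2 t)"
proof -
  have "continuous_on UNIV (\<lambda>x. Dx (gcol G j2) t x *v (matrix_inv (Jmat A F t x) *v gcol G j1 t x))"
    using assms unfolding index_one_def
    by (intro continuous_on_matrix_vector_mult continuous_on_matrix_inv_mult[where C = LJ]
        continuous_on_Jmat C12_slice) auto
  then show ?thesis
    by (simp add: milstein_coeff_def[abs_def] matrix_vector_mul_assoc)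
qed

text \<open>
  If \<open>R\<close> annihilates a column of \<open>G\<close> at every point of space, it also annihilates the derivative of that column.
\<close>

lemma matrix_mult_milstein_coeff_eq_0:
  fixes R :: "real^'d^'d"
  assumes R: "\<And>x. R ** G t x = 0" and diff: "gcol G j2 t differentiable (at x)"
  shows "R *v milstein_coeff A F G j1 j2 t x = 0"
proof -
  have col: "R *v gcol G j2 t x = 0" for x
    using arg_cong[OF R[of x], of "column j2"] by (simp add: column_def matrix_matrix_mult_def matrix_vector_mult_def vec_eq_iff)
  have "((\<lambda>x. R *v gcol G j2 t x) has_derivative (\<lambda>h. R *v (Dx (gcol G j2) t x *v h))) (at x)"
    using diff unfolding jacobian_works Dx_def
    by (rule bounded_linear.has_derivative[OF matrix_vector_mul_bounded_linear])
  then have "((\<lambda>x. 0) has_derivative (\<lambda>h. R *v (Dx (gcol G j2) t x *v h))) (at x)"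
    unfolding col .
  then have "(\<lambda>h. R *v (Dx (gcol G j2) t x *v h)) = (\<lambda>h. 0)"
    by (rule has_derivative_unique) simp
  then have "R *v (Dx (gcol G j2) t x *v h) = 0" for h by metis
  then show ?thesis
    by (simp add: milstein_coeff_def flip: matrix_vector_mul_assoc)
qed

lemma index_one_map_expansive:
  assumes index: "index_one T A F G X0 LJ" and F: "C12 T F" and t: "t \<in> {0..T}"
  shows "dist x y \<le> LJ * dist (A t *v x + projR A t *v F t x) (A t *v y + projR A t *v F t y)"
proof (rule inverse_derivative_bound_imp_expansive[where J = "Jmat A F t"])
  show "0 < LJ" "\<And>x. invertible (Jmat A F t x)" "\<And>x. norm (matrix_inv (Jmat A F t x)) \<le> LJ"
    using index t unfolding index_one_def by auto
  show "continuous_on UNIV (Jmat A F t)" by (rule continuous_on_Jmat[OF F t])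
  fix x
  have "(F t has_derivative (*v) (Dx F t x)) (at x)"
    using C12_slice(3)[OF F t, of x] by (simp add: jacobian_works Dx_def)
  then have "((\<lambda>x. A t *v x + projR A t *v F t x) has_derivative
      (\<lambda>h. A t *v h + projR A t *v (Dx F t x *v h))) (at x)"
    by (intro has_derivative_add bounded_linear_imp_has_derivative
        bounded_linear.has_derivative[OF matrix_vector_mul_bounded_linear]) auto
  moreover have "(\<lambda>h. A t *v h + projR A t *v (Dx F t x *v h)) = (*v) (Jmat A F t x)"
    by (simp add: Jmat_def fun_eq_iff matrix_vector_mult_add_rdistrib matrix_vector_mul_assoc)
  ultimately show "((\<lambda>x. A t *v x + projR A t *v F t x) has_derivative (*v) (Jmat A F t x)) (at x)"
    by simp
qed

text \<open>The diffusion and Milstein terms of the monotonicity condition are nonnegative and can be dropped.\<close>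

lemma coupled_monotone_drift:
  assumes "coupled_monotone T A F G q p1 L1 \<Delta>0" and t: "t \<in> {0..T}"
  shows "2 * ((projP A t *v x - projP A t *v y) \<bullet> (mp_inverse (A t) *v F t x - mp_inverse (A t) *v F t y))
    \<le> L1 * (norm (x - y))\<^sup>2"
proof -
  let ?B = "mp_inverse (A t)"
  let ?m = "\<lambda>j1 j2 x. milstein_coeff A F G j1 j2 t x"
  have pos: "1 < q" "8 < p1" "0 < \<Delta>0"
    and le: "2 * ((projP A t *v x - projP A t *v y) \<bullet> (?B *v F t x - ?B *v F t y))
      + (p1 - 1) * (norm (?B ** G t x - ?B ** G t y))\<^sup>2
      + q / 2 * \<Delta>0 * (\<Sum>j1\<in>UNIV. \<Sum>j2\<in>UNIV. (norm (?B *v ?m j1 j2 x - ?B *v ?m j1 j2 y))\<^sup>2)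
      \<le> L1 * (norm (x - y))\<^sup>2"
    using assms unfolding coupled_monotone_def by auto
  have "0 \<le> (p1 - 1) * (norm (?B ** G t x - ?B ** G t y))\<^sup>2" using pos by simp
  moreover have "0 \<le> q / 2 * \<Delta>0 * (\<Sum>j1\<in>UNIV. \<Sum>j2\<in>UNIV. (norm (?B *v ?m j1 j2 x - ?B *v ?m j1 j2 y))\<^sup>2)"
    using pos by (intro mult_nonneg_nonneg sum_nonneg) auto
  ultimately show ?thesis using le by linarith
qed

lemma implicit_theta_map_homeomorphism:
  fixes A :: "real \<Rightarrow> real^('d::{finite,linorder})^('d::{finite,linorder})"
  assumes struct: "matrix_structure T A" and index: "index_one T A F G X0 LJ"
    and mono: "coupled_monotone T A F G q p1 L1 \<Delta>0" and F: "C12 T F"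
    and t: "t \<in> {0..T}" and "0 < \<tau>"
    and small: "4 * \<tau> * L1 * (1 + L\<^sup>2) \<le> 1" and L: "(SUP t\<in>{0..T}. norm (A t)) * LJ \<le> L"
  shows "bij (\<lambda>x. A t *v x - \<tau> *\<^sub>R F t x)" and "continuous_on UNIV (inv (\<lambda>x. A t *v x - \<tau> *\<^sub>R F t x))"
proof -
  have LJ: "0 < LJ" and L1: "0 < L1"
    using index mono by (auto simp: index_one_def coupled_monotone_def)
  have AL: "norm (A t) * LJ \<le> L"
    using mult_right_mono[OF matrix_structure_norm_le_SUP[OF struct t], of LJ] LJ L by linarith
  have "A t ** mp_inverse (A t) ** A t = A t"
    using matrix_structure_is_mp_inverse[OF struct t] by (simp add: is_mp_inverse_def)
  then obtain c where c: "\<And>x y. dist x y \<le> c * dist (A t *v x - \<tau> *\<^sub>R F t x) (A t *v y - \<tau> *\<^sub>R F t y)"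
    by (rule implicit_theta_map_expansive[OF _ index_one_map_expansive[OF index F t, unfolded projR_def]
          coupled_monotone_drift[OF mono t, unfolded projP_def] \<open>0 < \<tau>\<close> LJ L1 small AL]) (rule that)
  have cont: "continuous_on UNIV (\<lambda>x. A t *v x - \<tau> *\<^sub>R F t x)"
    by (intro continuous_intros continuous_on_matrix_vector_mult C12_slice(1)[OF F t])
  show "bij (\<lambda>x. A t *v x - \<tau> *\<^sub>R F t x)" "continuous_on UNIV (inv (\<lambda>x. A t *v x - \<tau> *\<^sub>R F t x))"
    using expansive_imp_homeomorphism[OF cont c] by auto
qed

lemma iterated_ito_integral_measurable:
  assumes "iterated_ito_integral M Fl B1 B2 s t Z" "filtration_on T M Fl" "t \<in> {0..T}"
  shows "Z \<in> borel_measurable M"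
proof -
  have "Z \<in> borel_measurable (Fl t)"
    using assms(1) unfolding iterated_ito_integral_def ito_integral_def by auto
  moreover have "subalgebra M (Fl t)"
    using assms(2,3) unfolding filtration_on_def by auto
  ultimately show ?thesis by (rule measurable_from_subalg[rotated])
qed

section \<open>Well-posedness of the scheme\<close>

theorem lemma3p1:
  fixes T \<theta> LJ q p1 L1 \<Delta>0 :: real
    and A :: "real \<Rightarrow> real^('d::{finite,linorder})^('d::{finite,linorder})"
    and F :: "real \<Rightarrow> real^('d::{finite,linorder}) \<Rightarrow> real^('d::{finite,linorder})"
    and G :: "real \<Rightarrow> real^('d::{finite,linorder}) \<Rightarrow> real^'m^('d::{finite,linorder})"
    and X0 :: "real^('d::{finite,linorder})"
    and M :: "'a measure"
    and Fl :: "real \<Rightarrow> 'a measure"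
    and W :: "real \<Rightarrow> 'a \<Rightarrow> real^'m"
    and K :: nat
    and I :: "'m \<Rightarrow> 'm \<Rightarrow> nat \<Rightarrow> 'a \<Rightarrow> real"
  defines "Lhat \<equiv> (SUP t\<in>{0..T}. norm (A t)) * LJ + real CARD('d)"
  defines "\<Delta>bar \<equiv> min \<Delta>0 (1 / (4 * \<theta> * L1 * (1 + Lhat\<^sup>2)))"
  defines "\<Delta> \<equiv> T / real K"
  assumes "0 < T"
    and "prob_space M" "filtration_on T M Fl" "brownian_motion T M Fl W"
    and "matrix_structure T A"
    and "index_one T A F G X0 LJ"
    and "coupled_monotone T A F G q p1 L1 \<Delta>0"
    and "poly_regular T F G p1"
    and "1 / 2 \<le> \<theta>" "\<theta> \<le> 1"
    and "0 < \<Delta>" "\<Delta> \<le> \<Delta>bar"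
    and "\<And>j1 j2 k. k < K \<Longrightarrow>
           iterated_ito_integral M Fl (\<lambda>t \<omega>. W t \<omega> $ j1) (\<lambda>t \<omega>. W t \<omega> $ j2)
             (real k * \<Delta>) (real (Suc k) * \<Delta>) (I j1 j2 k)"
  shows "\<exists>X :: nat \<Rightarrow> 'a \<Rightarrow> real^('d::{finite,linorder}).
           (\<forall>k\<le>K. X k \<in> borel_measurable M) \<and>
           (\<forall>\<omega>\<in>space M.
              theta_milstein A F G X0 \<theta> \<Delta> K (\<lambda>t. W t \<omega>) (\<lambda>j1 j2 k. I j1 j2 k \<omega>) (\<lambda>k. X k \<omega>) \<and>
              (\<forall>y. theta_milstein A F G X0 \<theta> \<Delta> K (\<lambda>t. W t \<omega>) (\<lambda>j1 j2 k. I j1 j2 k \<omega>) y \<longrightarrow>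
                   (\<forall>k\<le>K. y k = X k \<omega>)) \<and>
              (\<forall>k\<le>K. X k \<omega> \<in> constraint_manifold A F (real k * \<Delta>)))"
proof -
  note filtration = \<open>filtration_on T M Fl\<close> and struct = \<open>matrix_structure T A\<close>
    and index = \<open>index_one T A F G X0 LJ\<close> and mono = \<open>coupled_monotone T A F G q p1 L1 \<Delta>0\<close>
    and ito = \<open>\<And>j1 j2 k. k < K \<Longrightarrow> iterated_ito_integral M Fl (\<lambda>t \<omega>. W t \<omega> $ j1) (\<lambda>t \<omega>. W t \<omega> $ j2)
             (real k * \<Delta>) (real (Suc k) * \<Delta>) (I j1 j2 k)\<close>
  define \<tau> where "\<tau> = \<theta> * \<Delta>"
  define tk where "tk k = real k * \<Delta>" for k
  have F: "C12 T F" and G: "\<And>j. C12 T (gcol G j)"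
    using \<open>poly_regular T F G p1\<close> unfolding poly_regular_def by auto
  have L1: "0 < L1" and "0 < LJ"
    using index mono by (auto simp: index_one_def coupled_monotone_def)
  have "0 < \<tau>" using \<open>0 < \<Delta>\<close> \<open>1 / 2 \<le> \<theta>\<close> by (simp add: \<tau>_def)
  have small: "4 * \<tau> * L1 * (1 + Lhat\<^sup>2) \<le> 1"
  proof -
    have "0 < 4 * \<theta> * L1 * (1 + Lhat\<^sup>2)"
      using L1 \<open>1 / 2 \<le> \<theta>\<close> by (intro mult_pos_pos add_pos_nonneg) auto
    moreover have "\<Delta> \<le> 1 / (4 * \<theta> * L1 * (1 + Lhat\<^sup>2))"
      using \<open>\<Delta> \<le> \<Delta>bar\<close> by (simp add: \<Delta>bar_def)
    ultimately have "\<Delta> * (4 * \<theta> * L1 * (1 + Lhat\<^sup>2)) \<le> 1"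
      by (simp only: pos_le_divide_eq)
    then show ?thesis by (simp add: \<tau>_def ac_simps)
  qed
  have tk: "tk k \<in> {0..T}" if "k \<le> K" for k
  proof -
    have "0 < K" using \<open>0 < \<Delta>\<close> by (intro gr0I) (simp add: \<Delta>_def)
    then have "real k * (T / real K) \<le> real K * (T / real K)"
      using that \<open>0 < T\<close> by (intro mult_right_mono) auto
    then show ?thesis using \<open>0 < K\<close> \<open>0 < T\<close> by (simp add: tk_def \<Delta>_def)
  qed
  define \<Phi> where "\<Phi> k x = A (tk k) *v x - \<tau> *\<^sub>R F (tk k) x" for k x
  have \<Phi>: "bij (\<Phi> k)" "continuous_on UNIV (inv (\<Phi> k))" if "k \<le> K" for k
    using implicit_theta_map_homeomorphism[OF struct index mono F tk[OF that] \<open>0 < \<tau>\<close> small]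
    by (simp_all add: \<Phi>_def[abs_def] Lhat_def)
  \<comment> \<open>The explicit part of the step, and the matrix that makes the implicit part a function of \<open>\<Phi>\<close> alone.\<close>
  define \<xi> where "\<xi> k x \<omega> = A (tk k) *v x + ((1 - \<theta>) * \<Delta>) *\<^sub>R F (tk k) x
      + G (tk k) x *v (W (tk (Suc k)) \<omega> - W (tk k) \<omega>)
      + (\<Sum>j1\<in>UNIV. \<Sum>j2\<in>UNIV. I j1 j2 k \<omega> *\<^sub>R milstein_coeff A F G j1 j2 (tk k) x)" for k x \<omega>
  define N where "N k = A (tk (Suc k)) ** mp_inverse (A (tk k)) + projR A (tk k)" for k
  define X where "X k \<omega> = rec_nat X0 (\<lambda>k x. inv (\<Phi> (Suc k)) (N k *v \<xi> k x \<omega>)) k" for k \<omega>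
  obtain P R where P: "\<And>t. t \<in> {0..T} \<Longrightarrow> projP A t = P" and R: "\<And>t. t \<in> {0..T} \<Longrightarrow> projR A t = R"
    using projectors_constant[OF struct] by blast
  have scheme: "theta_milstein A F G X0 \<theta> \<Delta> K (\<lambda>t. W t \<omega>) (\<lambda>j1 j2 k. I j1 j2 k \<omega>) y
      \<longleftrightarrow> y 0 = X0 \<and> (\<forall>k<K. A (tk k) *v y (Suc k) = \<xi> k (y k) \<omega> + \<tau> *\<^sub>R
            ((projR A (tk k) + A (tk k) ** mp_inverse (A (tk (Suc k)))) *v F (tk (Suc k)) (y (Suc k))))" for y \<omega>
    unfolding theta_milstein_def Let_def \<xi>_def tk_def \<tau>_def by (simp only: ac_simps)
  have step: "A (tk k) *v x = \<xi>' + \<tau> *\<^sub>R ((projR A (tk k) + A (tk k) ** mp_inverse (A (tk (Suc k)))) *v F (tk (Suc k)) x)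
      \<longleftrightarrow> x = inv (\<Phi> (Suc k)) (N k *v \<xi>')" if "k < K" for k x \<xi>'
  proof -
    have t: "tk k \<in> {0..T}" "tk (Suc k) \<in> {0..T}" using tk that by auto
    note mp = t[THEN matrix_structure_is_mp_inverse[OF struct], unfolded is_mp_inverse_def]
    have QQ: "A (tk (Suc k)) ** mp_inverse (A (tk (Suc k))) = A (tk k) ** mp_inverse (A (tk k))"
      using R[OF t(1)] R[OF t(2)] unfolding projR_def by (metis diff_diff_eq2 add_diff_cancel_left')
    have PP: "mp_inverse (A (tk (Suc k))) ** A (tk (Suc k)) = mp_inverse (A (tk k)) ** A (tk k)"
      using P[OF t(1)] P[OF t(2)] unfolding projP_def by metis
    have "A (tk k) *v x = \<xi>' + \<tau> *\<^sub>R ((projR A (tk k) + A (tk k) ** mp_inverse (A (tk (Suc k)))) *v F (tk (Suc k)) x)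
      \<longleftrightarrow> \<Phi> (Suc k) x = N k *v \<xi>'"
      unfolding projR_def \<Phi>_def N_def using mp by (intro theta_step_rewrite PP QQ) auto
    also have "\<dots> \<longleftrightarrow> x = inv (\<Phi> (Suc k)) (N k *v \<xi>')"
      using \<Phi>(1)[of "Suc k"] that by (metis Suc_leI bij_inv_eq_iff)
    finally show ?thesis .
  qed
  have X_Suc: "X (Suc k) \<omega> = inv (\<Phi> (Suc k)) (N k *v \<xi> k (X k \<omega>) \<omega>)" and X_0: "X 0 \<omega> = X0" for k \<omega>
    by (simp_all add: X_def)
  have solution: "theta_milstein A F G X0 \<theta> \<Delta> K (\<lambda>t. W t \<omega>) (\<lambda>j1 j2 k. I j1 j2 k \<omega>) y
      \<longleftrightarrow> (\<forall>k\<le>K. y k = X k \<omega>)" for y \<omega>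
  proof -
    have "theta_milstein A F G X0 \<theta> \<Delta> K (\<lambda>t. W t \<omega>) (\<lambda>j1 j2 k. I j1 j2 k \<omega>) y
      \<longleftrightarrow> y 0 = X0 \<and> (\<forall>k<K. y (Suc k) = inv (\<Phi> (Suc k)) (N k *v \<xi> k (y k) \<omega>))"
      unfolding scheme using step by auto
    also have "\<dots> \<longleftrightarrow> (\<forall>k\<le>K. y k = X k \<omega>)"
    proof (intro iffI allI impI conjI, elim conjE)
      fix k assume y: "y 0 = X0" "\<forall>k<K. y (Suc k) = inv (\<Phi> (Suc k)) (N k *v \<xi> k (y k) \<omega>)" and "k \<le> K"
      from \<open>k \<le> K\<close> show "y k = X k \<omega>"
        by (induction k) (simp_all add: y X_0 X_Suc)
    qed (simp_all add: X_0 X_Suc)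
    finally show ?thesis .
  qed
  \<comment> \<open>Apply \<open>R\<close> to the recursion: only the two drift terms survive.\<close>
  have manifold: "X k \<omega> \<in> constraint_manifold A F (tk k)" if "k \<le> K" for k \<omega>
    using that
  proof (induction k)
    case 0
    then show ?case using index by (simp add: X_0 tk_def constraint_manifold_def index_one_def)
  next
    case (Suc k)
    have t: "tk k \<in> {0..T}" "tk (Suc k) \<in> {0..T}" using tk Suc.prems by auto
    let ?B' = "mp_inverse (A (tk (Suc k)))"
    have RA: "R *v (A (tk k) *v v) = 0" for v
      using matrix_structure_is_mp_inverse[OF struct t(1)]
      unfolding R[OF t(1), symmetric] projR_def matrix_vector_mult_diff_rdistrib
      by (simp add: is_mp_inverse_def matrix_vector_mul_assoc)
    have RR: "R *v (R *v v) = R *v v" for v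
    proof -
      have "R *v v = v - A (tk k) *v (mp_inverse (A (tk k)) *v v)"
        unfolding R[OF t(1), symmetric] projR_def matrix_vector_mult_diff_rdistrib
        by (simp add: matrix_vector_mul_assoc)
      then show ?thesis by (metis RA diff_zero matrix_vector_mult_diff_distrib)
    qed
    have "R *v F (tk k) (X k \<omega>) = 0"
      using Suc R[OF t(1)] by (simp add: constraint_manifold_def)
    moreover have "R *v (G (tk k) x *v v) = 0" for x v
      using index t(1) R[OF t(1)] by (auto simp: index_one_def matrix_vector_mul_assoc)
    moreover have "R *v milstein_coeff A F G j1 j2 (tk k) x = 0" for j1 j2 x
      using index t(1) R[OF t(1)] C12_slice(3)[OF G t(1)]
      by (intro matrix_mult_milstein_coeff_eq_0) (auto simp: index_one_def)
    ultimately have R\<xi>: "R *v \<xi> k (X k \<omega>) \<omega> = 0"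
      unfolding \<xi>_def
      by (simp add: matrix_vector_right_distrib matrix_vector_mult_scaleR RA
          linear_sum[OF matrix_vector_mul_linear] o_def)
    have "A (tk k) *v X (Suc k) \<omega> = \<xi> k (X k \<omega>) \<omega>
        + \<tau> *\<^sub>R ((R + A (tk k) ** ?B') *v F (tk (Suc k)) (X (Suc k) \<omega>))"
      using step[of k "X (Suc k) \<omega>"] X_Suc R[OF t(1)] Suc.prems by simp
    from arg_cong[OF this, of "(*v) R"] have "\<tau> *\<^sub>R (R *v F (tk (Suc k)) (X (Suc k) \<omega>)) = 0"
      by (simp add: RA R\<xi> RR matrix_vector_right_distrib matrix_vector_mult_scaleR
          matrix_vector_mult_add_rdistrib flip: matrix_vector_mul_assoc)
    then show ?case
      using \<open>0 < \<tau>\<close> R[OF t(2)] by (simp add: constraint_manifold_def)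
  qed
  \<comment> \<open>Each step composes continuous maps with \<open>X k\<close>, Brownian increments and iterated integrals.\<close>
  have measurable: "X k \<in> borel_measurable M" if "k \<le> K" for k
    using that
  proof (induction k)
    case 0
    then show ?case by (simp add: X_0[abs_def])
  next
    case (Suc k)
    have t: "tk k \<in> {0..T}" "tk (Suc k) \<in> {0..T}" using tk Suc.prems by auto
    have [measurable]: "X k \<in> borel_measurable M" using Suc by simp
    have comp: "(\<lambda>\<omega>. g (Y \<omega>)) \<in> borel_measurable M"
      if "continuous_on UNIV g" "Y \<in> borel_measurable M"
      for g :: "'x::topological_space \<Rightarrow> 'y::topological_space" and Y
      using that by (intro measurable_compose[OF that(2)] borel_measurable_continuous_onI)
    have W: "W s \<in> borel_measurable M" if "s \<in> {0..T}" for s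
      using \<open>brownian_motion T M Fl W\<close> filtration that unfolding brownian_motion_def filtration_on_def
      by (blast intro: measurable_from_subalg)
    have [measurable]: "I j1 j2 k \<in> borel_measurable M" for j1 j2
      using iterated_ito_integral_measurable[OF ito filtration, of k j1 j2] t(2) Suc.prems by (simp add: tk_def)
    have [measurable]: "(\<lambda>\<omega>. (W (tk (Suc k)) \<omega> - W (tk k) \<omega>) $ j) \<in> borel_measurable M" for j
      using W t by (intro comp[of "\<lambda>v. v $ j"] continuous_intros borel_measurable_diff) auto
    have [measurable]: "(\<lambda>\<omega>. gcol G j (tk k) (X k \<omega>)) \<in> borel_measurable M" for j
      by (rule comp[OF C12_slice(1)[OF G t(1)]]) measurable
    have [measurable]: "(\<lambda>\<omega>. F (tk k) (X k \<omega>)) \<in> borel_measurable M"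
      by (rule comp[OF C12_slice(1)[OF F t(1)]]) measurable
    have [measurable]: "(\<lambda>\<omega>. milstein_coeff A F G j1 j2 (tk k) (X k \<omega>)) \<in> borel_measurable M" for j1 j2
      by (rule comp[OF continuous_on_milstein_coeff[OF index F G t(1)]]) measurable
    have [measurable]: "(\<lambda>\<omega>. A (tk k) *v X k \<omega>) \<in> borel_measurable M"
      by (rule comp[OF linear_continuous_on[OF matrix_vector_mul_bounded_linear]]) measurable
    have "(\<lambda>\<omega>. \<xi> k (X k \<omega>) \<omega>) \<in> borel_measurable M"
      unfolding \<xi>_def matrix_mult_sum[of "G _ _"] scalar_mult_eq_scaleR by measurable
    then have "(\<lambda>\<omega>. N k *v \<xi> k (X k \<omega>) \<omega>) \<in> borel_measurable M"
      by (rule comp[OF linear_continuous_on[OF matrix_vector_mul_bounded_linear]])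
    then have "(\<lambda>\<omega>. inv (\<Phi> (Suc k)) (N k *v \<xi> k (X k \<omega>) \<omega>)) \<in> borel_measurable M"
      by (rule comp[OF \<Phi>(2)[OF Suc.prems]])
    then show ?case by (simp add: X_Suc[abs_def])
  qed
  show ?thesis
    using solution manifold measurable by (intro exI[of _ X]) (auto simp: tk_def)
qed

end
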